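(* Let $\mathcal{A}$ be a computable equivalence structure with degree of bi-embeddable categoricity $\mathbf{0}'$. (1) If $\mathcal{A}$ has no infinite equivalence classes, then the index set $\{e : \mathcal{C}_e \text{ is bi-embeddable with } \mathcal{A}\}$ is $\Pi^0_3$-complete. (2) If $\mathcal{A}$ has $k$ infinite equivalence classes, where $0<k<\omega$, then the index set $\{e : \mathcal{C}_e \text{ is bi-embeddable with } \mathcal{A}\}$ is $D^0_3$-complete.
   Context: An equivalence structure $\mathcal{A}=(A,E)$ has universe $A\subseteq\omega$ and an equivalence relation $E$ on $A$; it is computable if its atomic diagram is computable. Two structures are bi-embeddable if each embeds into the other. The degree of bi-embeddable categoricity of a computable structure $\mathcal{A}$ is the least Turing degree $\mathbf{d}$ (if it exists) such that for any two computable structures bi-embeddable with $\mathcal{A}$, $\mathbf{d}$ computes embeddings between them in both directions. $(\mathcal{C}_e)_{e\in\omega}$ is the enumeration of partial computable equivalence structures: for the $e$-th partial computable function $\phi_e:\omega\times\omega\to\{0,1\}$, $\mathcal{C}_e$ has universe $\omega$ and $x E^{\mathcal{C}_e} y$ iff $\phi_e(x,y)=1$. A set is $D^0_n$ if it is the intersection of a $\Sigma^0_n$ set and a $\Pi^0_n$ set. For a class $\Gamma$, a set is $\Gamma$-complete if it is in $\Gamma$ and every set in $\Gamma$ is many-one reducible to it via a computable function. *)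

theory Defs
  imports Main "HOL-Library.Nat_Bijection"
begin

datatype recf =
    Zf
  | Sf
  | Pf nat
  | Cf recf "recf list"
  | Rf recf recf
  | Mf recf
  | Of

inductive eval :: "(nat \<Rightarrow> nat) \<Rightarrow> recf \<Rightarrow> nat list \<Rightarrow> nat \<Rightarrow> bool"
  for orc :: "nat \<Rightarrow> nat" where
  ev_Z: "eval orc Zf xs 0"
| ev_S: "eval orc Sf (x # xs) (Suc x)"
| ev_P: "i < length xs \<Longrightarrow> eval orc (Pf i) xs (xs ! i)"
| ev_C: "list_all2 (\<lambda>g y. eval orc g xs y) gs ys \<Longrightarrow> eval orc f ys z \<Longrightarrow> eval orc (Cf f gs) xs z"
| ev_R0: "eval orc f xs y \<Longrightarrow> eval orc (Rf f g) (0 # xs) y"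
| ev_RS: "eval orc (Rf f g) (n # xs) y \<Longrightarrow> eval orc g (n # y # xs) z \<Longrightarrow>
          eval orc (Rf f g) (Suc n # xs) z"
| ev_M: "eval orc f (n # xs) 0 \<Longrightarrow> (\<forall>m<n. \<exists>y. eval orc f (m # xs) y \<and> y \<noteq> 0) \<Longrightarrow>
          eval orc (Mf f) xs n"
| ev_O: "eval orc Of (x # xs) (orc x)"
monos list_all2_mono

fun code :: "recf \<Rightarrow> nat" where
  "code Zf = prod_encode (0, 0)"
| "code Sf = prod_encode (1, 0)"
| "code (Pf i) = prod_encode (2, i)"
| "code (Cf f gs) = prod_encode (3, prod_encode (code f, list_encode (map code gs)))"
| "code (Rf f g) = prod_encode (4, prod_encode (code f, code g))"
| "code (Mf f) = prod_encode (5, code f)"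
| "code Of = prod_encode (6, 0)"

definition decode :: "nat \<Rightarrow> recf" where
  "decode e = (if e \<in> range code then inv code e else Zf)"

definition no_oracle :: "nat \<Rightarrow> nat" where
  "no_oracle = (\<lambda>_. 0)"

definition chi :: "nat set \<Rightarrow> nat \<Rightarrow> nat" where
  "chi S x = (if x \<in> S then 1 else 0)"

definition computable_in :: "(nat \<Rightarrow> nat) \<Rightarrow> (nat \<Rightarrow> nat) \<Rightarrow> bool" where
  "computable_in orc f \<longleftrightarrow> (\<exists>c. \<forall>x. eval orc c [x] (f x))"

definition computable :: "(nat \<Rightarrow> nat) \<Rightarrow> bool" where
  "computable f \<longleftrightarrow> computable_in no_oracle f"

definition computable2 :: "(nat \<Rightarrow> nat \<Rightarrow> nat) \<Rightarrow> bool" where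
  "computable2 g \<longleftrightarrow> (\<exists>c. \<forall>x y. eval no_oracle c [x, y] (g x y))"

definition decidable :: "nat set \<Rightarrow> bool" where
  "decidable S \<longleftrightarrow> computable (chi S)"

definition turing_le :: "nat set \<Rightarrow> nat set \<Rightarrow> bool" where
  "turing_le X Y \<longleftrightarrow> computable_in (chi Y) (chi X)"

definition halting_set :: "nat set" where
  "halting_set = {e. \<exists>v. eval no_oracle (decode e) [e] v}"

fun Sigma0 :: "nat \<Rightarrow> nat set set" where
  "Sigma0 0 = {S. decidable S}"
| "Sigma0 (Suc n) = {S. \<exists>P. - P \<in> Sigma0 n \<and> S = {x. \<exists>y. prod_encode (x, y) \<in> P}}"

definition Pi0 :: "nat \<Rightarrow> nat set set" where
  "Pi0 n = {S. - S \<in> Sigma0 n}"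

definition D0 :: "nat \<Rightarrow> nat set set" where
  "D0 n = {S. \<exists>A B. A \<in> Sigma0 n \<and> B \<in> Pi0 n \<and> S = A \<inter> B}"

definition many_one_le :: "nat set \<Rightarrow> nat set \<Rightarrow> bool" where
  "many_one_le S T \<longleftrightarrow> (\<exists>f. computable f \<and> (\<forall>x. x \<in> S \<longleftrightarrow> f x \<in> T))"

definition complete_for :: "nat set set \<Rightarrow> nat set \<Rightarrow> bool" where
  "complete_for \<Gamma> S \<longleftrightarrow> S \<in> \<Gamma> \<and> (\<forall>T \<in> \<Gamma>. many_one_le T S)"

definition computable_structure :: "nat set \<Rightarrow> (nat \<Rightarrow> nat \<Rightarrow> bool) \<Rightarrow> bool" where
  "computable_structure U E \<longleftrightarrow>
     decidable U \<and> computable2 (\<lambda>x y. if E x y then 1 else 0)"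

definition equivalence_structure :: "nat set \<Rightarrow> (nat \<Rightarrow> nat \<Rightarrow> bool) \<Rightarrow> bool" where
  "equivalence_structure U E \<longleftrightarrow> equiv U {(x, y). x \<in> U \<and> y \<in> U \<and> E x y}"

definition embedding ::
  "(nat \<Rightarrow> nat) \<Rightarrow> nat set \<Rightarrow> (nat \<Rightarrow> nat \<Rightarrow> bool) \<Rightarrow> nat set \<Rightarrow> (nat \<Rightarrow> nat \<Rightarrow> bool) \<Rightarrow> bool" where
  "embedding f U1 E1 U2 E2 \<longleftrightarrow>
     inj_on f U1 \<and> f ` U1 \<subseteq> U2 \<and> (\<forall>x\<in>U1. \<forall>y\<in>U1. E1 x y \<longleftrightarrow> E2 (f x) (f y))"

definition bi_embeddable ::
  "nat set \<Rightarrow> (nat \<Rightarrow> nat \<Rightarrow> bool) \<Rightarrow> nat set \<Rightarrow> (nat \<Rightarrow> nat \<Rightarrow> bool) \<Rightarrow> bool" where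
  "bi_embeddable U1 E1 U2 E2 \<longleftrightarrow>
     (\<exists>f. embedding f U1 E1 U2 E2) \<and> (\<exists>g. embedding g U2 E2 U1 E1)"

definition bec_computes :: "nat set \<Rightarrow> (nat \<Rightarrow> nat \<Rightarrow> bool) \<Rightarrow> nat set \<Rightarrow> bool" where
  "bec_computes U E X \<longleftrightarrow>
     (\<forall>U1 E1 U2 E2. computable_structure U1 E1 \<and> computable_structure U2 E2 \<and>
        bi_embeddable U1 E1 U E \<and> bi_embeddable U2 E2 U E \<longrightarrow>
        (\<exists>f. computable_in (chi X) f \<and> embedding f U1 E1 U2 E2) \<and>
        (\<exists>g. computable_in (chi X) g \<and> embedding g U2 E2 U1 E1))"

text \<open>The degree of bi-embeddable categoricity of (U, E) exists and equals \<open>0'\<close>: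
  \<open>0'\<close> computes such embeddings, and every degree that does computes \<open>0'\<close>.\<close>
definition bec_degree_is_jump :: "nat set \<Rightarrow> (nat \<Rightarrow> nat \<Rightarrow> bool) \<Rightarrow> bool" where
  "bec_degree_is_jump U E \<longleftrightarrow>
     bec_computes U E halting_set \<and> (\<forall>X. bec_computes U E X \<longrightarrow> turing_le halting_set X)"

definition Crel :: "nat \<Rightarrow> nat \<Rightarrow> nat \<Rightarrow> bool" where
  "Crel e x y \<longleftrightarrow> eval no_oracle (decode e) [x, y] 1"

definition C_is_structure :: "nat \<Rightarrow> bool" where
  "C_is_structure e \<longleftrightarrow>
     (\<forall>x y. \<exists>v. v \<le> 1 \<and> eval no_oracle (decode e) [x, y] v) \<and>
     equivalence_structure UNIV (Crel e)"

definition bi_emb_index_set :: "nat set \<Rightarrow> (nat \<Rightarrow> nat \<Rightarrow> bool) \<Rightarrow> nat set" where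
  "bi_emb_index_set U E = {e. C_is_structure e \<and> bi_embeddable UNIV (Crel e) U E}"

definition infinite_classes :: "nat set \<Rightarrow> (nat \<Rightarrow> nat \<Rightarrow> bool) \<Rightarrow> nat set set" where
  "infinite_classes U E = {C \<in> U // {(x, y). x \<in> U \<and> y \<in> U \<and> E x y}. infinite C}"

end

(*
  If only finitely many classes of a structure have more than m elements, then computable copies
  embed into each other computably: the exceptional classes are treated by a finite table, and all
  other classes go to classes of exactly the maximal size that occurs infinitely often. Hence degree
  0' forces classes of unbounded size, and among structures of unbounded class size the number k of
  infinite classes determines the bi-embeddability type. So C_e is bi-embeddable with A iff C_e is an
  equivalence structure (Pi_2) with at least k infinite classes (Sigma_3, trivial for k = 0), not
  more than k (Pi_3) and, for every n, with k + 1 classes of size at least n (Pi_2); asking for k + 1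
  classes avoids saying that the large classes are finite. Conversely, every Sigma_3 statement has
  the form "some column is infinite". Columns of a Sigma_3 set are turned into at most one infinite
  class, by starting a new class for column y whenever an earlier column receives an element;
  columns of the complement of a Pi_3 set are turned into two infinite classes each.
*)
theory Submission
  imports Defs "HOL-Library.Infinite_Set"
begin

section \<open>Evaluation of recursive functions\<close>

text \<open>Bounded class sizes contradict the degree because the empty oracle would then compute
  all the embeddings, hence decide the halting set. For unbounded sizes \<open>k\<close> is a
  complete invariant: infinite classes are matched bijectively, and finite ones go injectively to
  finite classes at least as large, which exist because at most \<open>k\<close> of the arbitrarily
  large classes are infinite. In both cases the embedding comes from a map of classes by matching
  ranks inside classes; in the bounded case this has to be computable.

  In the reduction of \<open>S \<inter> P\<close> the number of infinite classes must be
  \<open>k\<close> exactly on that set. For \<open>k > 0\<close> there are \<open>k - 1\<close>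
  permanent infinite classes, and for \<open>x \<in> P\<close> one more iff
  \<open>x \<in> S\<close>. If \<open>x \<notin> P\<close>, the count must miss \<open>k\<close>
  whatever holds for \<open>S\<close>; a single extra class could make up for the one missing when
  \<open>x \<notin> S\<close>, hence two per infinite column and a count of at least
  \<open>k + 1\<close>. Classes of all finite sizes are always present, so that bi-embeddability
  depends on the infinite classes alone.\<close>

abbreviation ev :: "recf \<Rightarrow> nat list \<Rightarrow> nat \<Rightarrow> bool" where
  "ev \<equiv> eval no_oracle"

text \<open>Determinism lets the value 0 stand for the negation of the value 1, which keeps later
  conditions positive in the evaluation relation.\<close>

lemma eval_deterministic: "eval orc c xs y \<Longrightarrow> eval orc c xs z \<Longrightarrow> y = z"
proof (induction arbitrary: z rule: eval.induct)
  case (ev_C xs gs ys f w)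
  from ev_C.prems obtain ys' where ys': "list_all2 (\<lambda>g y. eval orc g xs y) gs ys'" "eval orc f ys' z"
    by cases auto
  have "ys = ys'"
    using ev_C.IH(1) ys'(1) by (auto simp: list_all2_conv_all_nth intro!: nth_equalityI)
  then show ?case using ev_C.IH(2) ys'(2) by blast
next
  case (ev_RS f g n xs y w)
  from ev_RS.prems obtain y' where "eval orc (Rf f g) (n # xs) y'" "eval orc g (n # y' # xs) z"
    by cases auto
  then show ?case using ev_RS.IH by blast
next
  case (ev_M f n xs)
  from ev_M.prems have z: "eval orc f (z # xs) 0" "\<forall>m<z. \<exists>y. eval orc f (m # xs) y \<and> y \<noteq> 0"
    by (cases; auto)+
  show ?case
  proof (cases n z rule: linorder_cases)
    case less then show ?thesis using z(2) ev_M.IH(1) by blast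
  next
    case greater then show ?thesis using z(1) ev_M.IH(2) by blast
  qed
next
  case (ev_R0 f xs y g)
  from ev_R0.prems have "eval orc f xs z" by cases auto
  then show ?case using ev_R0.IH by blast
next
  case (ev_Z xs) then show ?case by cases auto
next
  case (ev_S x xs) then show ?case by cases auto
next
  case (ev_P i xs)
  from ev_P.prems show ?case by cases auto
next
  case (ev_O x xs) then show ?case by cases auto
qed

text \<open>Arguments form a list, so that recursion can push the counter and the previous value in
  front of the parameters.\<close>

definition rfun :: "nat \<Rightarrow> (nat list \<Rightarrow> nat) \<Rightarrow> bool" where
  "rfun n f \<longleftrightarrow> (\<exists>c. \<forall>xs. length xs = n \<longrightarrow> ev c xs (f xs))"

lemma rfunI: "(\<And>xs. length xs = n \<Longrightarrow> ev c xs (f xs)) \<Longrightarrow> rfun n f"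
  unfolding rfun_def by blast

lemma rfun_proj: "i < n \<Longrightarrow> rfun n (\<lambda>xs. xs ! i)"
  by (rule rfunI[where c = "Pf i"]) (auto intro: ev_P)

fun const_recf :: "nat \<Rightarrow> recf" where
  "const_recf 0 = Zf"
| "const_recf (Suc n) = Cf Sf [const_recf n]"

lemma ev_const_recf: "ev (const_recf k) xs k"
proof (induction k)
  case (Suc k)
  then show ?case by (auto intro!: ev_C[where ys = "[k]"] ev_S)
qed (auto intro: ev_Z)

lemma rfun_const: "rfun n (\<lambda>_. k)"
  by (rule rfunI[where c = "const_recf k"]) (rule ev_const_recf)

lemma rfun_comp1:
  assumes "rfun 1 (\<lambda>xs. f (xs ! 0))" "rfun n g"
  shows "rfun n (\<lambda>xs. f (g xs))"
proof -
  obtain cf where cf: "\<And>xs. length xs = 1 \<Longrightarrow> ev cf xs (f (xs ! 0))" using assms(1) unfolding rfun_def by blast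
  obtain cg where cg: "\<And>xs. length xs = n \<Longrightarrow> ev cg xs (g xs)" using assms(2) unfolding rfun_def by blast
  show ?thesis
    by (rule rfunI[where c = "Cf cf [cg]"], rule_tac ys = "[g xs]" in ev_C)
      (use cf[of "[_]"] cg in auto)
qed

lemma rfun_comp2:
  assumes "rfun 2 (\<lambda>xs. f (xs ! 0) (xs ! 1))" "rfun n g" "rfun n h"
  shows "rfun n (\<lambda>xs. f (g xs) (h xs))"
proof -
  obtain cf where cf: "\<And>xs. length xs = 2 \<Longrightarrow> ev cf xs (f (xs ! 0) (xs ! 1))"
    using assms(1) unfolding rfun_def by blast
  obtain cg where cg: "\<And>xs. length xs = n \<Longrightarrow> ev cg xs (g xs)" using assms(2) unfolding rfun_def by blast
  obtain ch where ch: "\<And>xs. length xs = n \<Longrightarrow> ev ch xs (h xs)" using assms(3) unfolding rfun_def by blast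
  show ?thesis
    by (rule rfunI[where c = "Cf cf [cg, ch]"], rule_tac ys = "[g xs, h xs]" in ev_C)
      (use cf[of "[_, _]"] cg ch in auto)
qed

lemma rfun_rec:
  assumes "rfun n a" "rfun (Suc (Suc n)) b" "rfun n h"
  shows "rfun n (\<lambda>xs. rec_nat (a xs) (\<lambda>k r. b (k # r # xs)) (h xs))"
proof -
  obtain ca where ca: "\<And>xs. length xs = n \<Longrightarrow> ev ca xs (a xs)" using assms(1) unfolding rfun_def by blast
  obtain cb where cb: "\<And>xs. length xs = Suc (Suc n) \<Longrightarrow> ev cb xs (b xs)"
    using assms(2) unfolding rfun_def by blast
  obtain ch where ch: "\<And>xs. length xs = n \<Longrightarrow> ev ch xs (h xs)" using assms(3) unfolding rfun_def by blast
  have rec: "ev (Rf ca cb) (m # xs) (rec_nat (a xs) (\<lambda>k r. b (k # r # xs)) m)"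
    if "length xs = n" for m xs
  proof (induction m)
    case 0 then show ?case using ca that by (auto intro: ev_R0)
  next
    case (Suc m) then show ?case using cb that by (auto intro: ev_RS)
  qed
  \<comment> \<open>\<open>Rf\<close> recurses on the head of its argument list; the projections
    copy the parameters behind the computed depth \<open>h xs\<close>.\<close>
  have "list_all2 (\<lambda>g y. ev g xs y) (map Pf [0..<n]) xs" if "length xs = n" for xs
    using that by (auto simp: list_all2_conv_all_nth intro!: ev_P)
  then show ?thesis
    by (intro rfunI[where c = "Cf (Rf ca cb) (ch # map Pf [0..<n])"], rule_tac ys = "h xs # xs" in ev_C)
      (use ch rec in auto)
qed

lemma rfun_Least:
  assumes "rfun (Suc n) f" and ex: "\<And>xs. length xs = n \<Longrightarrow> \<exists>k. f (k # xs) = 0"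
  shows "rfun n (\<lambda>xs. LEAST k. f (k # xs) = 0)"
proof -
  obtain cf where cf: "\<And>xs. length xs = Suc n \<Longrightarrow> ev cf xs (f xs)" using assms(1) unfolding rfun_def by blast
  have "ev (Mf cf) xs (LEAST k. f (k # xs) = 0)" if "length xs = n" for xs
  proof (rule ev_M)
    have "f ((LEAST k. f (k # xs) = 0) # xs) = 0" using ex[OF that] by (rule LeastI_ex)
    then show "ev cf ((LEAST k. f (k # xs) = 0) # xs) 0" using cf[of "_ # xs"] that by (metis length_Cons)
    show "\<forall>m<LEAST k. f (k # xs) = 0. \<exists>y. ev cf (m # xs) y \<and> y \<noteq> 0"
      using cf[of "_ # xs"] that not_less_Least by (metis (mono_tags, lifting) length_Cons)
  qed
  then show ?thesis by (rule rfunI)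
qed

lemma computable_iff_rfun: "computable f \<longleftrightarrow> rfun 1 (\<lambda>xs. f (xs ! 0))"
proof
  assume "computable f"
  then obtain c where "\<And>x. ev c [x] (f x)" unfolding computable_def computable_in_def by blast
  then show "rfun 1 (\<lambda>xs. f (xs ! 0))" by (intro rfunI[where c = c]) (auto simp: length_Suc_conv)
next
  assume "rfun 1 (\<lambda>xs. f (xs ! 0))"
  then obtain c where "\<And>xs. length xs = 1 \<Longrightarrow> ev c xs (f (xs ! 0))" unfolding rfun_def by blast
  from this[of "[_]"] have "\<forall>x. ev c [x] (f x)" by simp
  then show "computable f" unfolding computable_def computable_in_def by blast
qed

lemma computable2_iff_rfun: "computable2 f \<longleftrightarrow> rfun 2 (\<lambda>xs. f (xs ! 0) (xs ! 1))"
proof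
  assume "computable2 f"
  then obtain c where "\<And>x y. ev c [x, y] (f x y)" unfolding computable2_def by blast
  then show "rfun 2 (\<lambda>xs. f (xs ! 0) (xs ! 1))"
    by (intro rfunI[where c = c]) (auto simp: length_Suc_conv numeral_2_eq_2)
next
  assume "rfun 2 (\<lambda>xs. f (xs ! 0) (xs ! 1))"
  then obtain c where "\<And>xs. length xs = 2 \<Longrightarrow> ev c xs (f (xs ! 0) (xs ! 1))" unfolding rfun_def by blast
  from this[of "[_, _]"] have "\<forall>x y. ev c [x, y] (f x y)" by simp
  then show "computable2 f" unfolding computable2_def by blast
qed

lemma rfun_Suc: "rfun n g \<Longrightarrow> rfun n (\<lambda>xs. Suc (g xs))"
  by (rule rfun_comp1[where f = Suc], rule rfunI[where c = Sf])
    (auto simp: length_Suc_conv intro: ev_S)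

lemma rfun_add:
  assumes "rfun n g" "rfun n h" shows "rfun n (\<lambda>xs. g xs + h xs)"
proof -
  have "rfun (Suc (Suc n)) (\<lambda>ys. Suc (ys ! 1))" by (intro rfun_Suc rfun_proj) simp
  from rfun_rec[OF assms(1) this assms(2)]
  have "rfun n (\<lambda>xs. rec_nat (g xs) (\<lambda>k r. Suc r) (h xs))" by simp
  moreover have "rec_nat a (\<lambda>k r. Suc r) b = a + b" for a b
    by (induction b) auto
  ultimately show ?thesis by simp
qed

lemma rfun_mult:
  assumes "rfun n g" "rfun n h" shows "rfun n (\<lambda>xs. g xs * h xs)"
proof -
  \<comment> \<open>In the recursion body position 0 holds the counter, 1 the partial sum and 2 the
    first factor.\<close>
  have "rfun (Suc (Suc 2)) (\<lambda>ys. ys ! 1 + ys ! 2)" by (intro rfun_add rfun_proj) simp_all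
  from rfun_rec[OF rfun_const this rfun_proj[of 1]]
  have "rfun 2 (\<lambda>xs. rec_nat 0 (\<lambda>k r. r + xs ! 0) (xs ! 1))" by simp
  moreover have "rec_nat 0 (\<lambda>k r. r + a) b = a * b" for a b :: nat
    by (induction b) auto
  ultimately have "rfun 2 (\<lambda>xs. xs ! 0 * xs ! 1)" by simp
  then show ?thesis using assms by (rule rfun_comp2[where f = "(*)"])
qed

lemma rfun_pred:
  assumes "rfun n g" shows "rfun n (\<lambda>xs. g xs - 1)"
proof -
  have "rfun (Suc (Suc n)) (\<lambda>ys. ys ! 0)" by (rule rfun_proj) simp
  from rfun_rec[OF rfun_const this assms]
  have "rfun n (\<lambda>xs. rec_nat 0 (\<lambda>k r. k) (g xs))" by simp
  moreover have "rec_nat 0 (\<lambda>k r. k) b = b - 1" for b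
    by (cases b) auto
  ultimately show ?thesis by simp
qed

lemma rfun_diff:
  assumes "rfun n g" "rfun n h" shows "rfun n (\<lambda>xs. g xs - h xs)"
proof -
  have "rfun (Suc (Suc n)) (\<lambda>ys. ys ! 1 - 1)" by (intro rfun_pred rfun_proj) simp
  from rfun_rec[OF assms(1) this assms(2)]
  have "rfun n (\<lambda>xs. rec_nat (g xs) (\<lambda>k r. r - 1) (h xs))" by simp
  moreover have "rec_nat a (\<lambda>k r. r - 1) b = a - b" for a b :: nat
    by (induction b) auto
  ultimately show ?thesis by simp
qed

lemma rfun_triangle:
  assumes "rfun n g" shows "rfun n (\<lambda>xs. triangle (g xs))"
proof -
  have "rfun (Suc (Suc n)) (\<lambda>ys. ys ! 1 + Suc (ys ! 0))"
    by (intro rfun_add rfun_Suc rfun_proj) simp_all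
  from rfun_rec[OF rfun_const this assms]
  have "rfun n (\<lambda>xs. rec_nat 0 (\<lambda>k r. r + Suc k) (g xs))" by simp
  moreover have "rec_nat 0 (\<lambda>k r. r + Suc k) b = triangle b" for b
    by (induction b) auto
  ultimately show ?thesis by simp
qed

section \<open>Computability of the inverse of the pairing function\<close>

definition pfst :: "nat \<Rightarrow> nat" where "pfst z = fst (prod_decode z)"
definition psnd :: "nat \<Rightarrow> nat" where "psnd z = snd (prod_decode z)"

lemma pfst_pair [simp]: "pfst (prod_encode (a, b)) = a" by (simp add: pfst_def)
lemma psnd_pair [simp]: "psnd (prod_encode (a, b)) = b" by (simp add: psnd_def)
lemma pair_eta [simp]: "prod_encode (pfst z, psnd z) = z" by (simp add: pfst_def psnd_def)

lemma triangle_mono: "m \<le> n \<Longrightarrow> triangle m \<le> triangle n"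
  by (induction n) (auto simp: le_Suc_eq)

text \<open>The diagonal index of a pair is the least \<open>k\<close> with \<open>z < triangle (Suc k)\<close>.\<close>
lemma Least_triangle: "(LEAST k. Suc (prod_encode (a, b)) - triangle (Suc k) = 0) = a + b"
proof (rule Least_equality)
  show "Suc (prod_encode (a, b)) - triangle (Suc (a + b)) = 0" by (simp add: prod_encode_def)
  fix k assume k: "Suc (prod_encode (a, b)) - triangle (Suc k) = 0"
  show "a + b \<le> k"
  proof (rule ccontr)
    assume "\<not> a + b \<le> k"
    then have "triangle (Suc k) \<le> triangle (a + b)" by (intro triangle_mono) simp
    then show False using k by (simp add: prod_encode_def)
  qed
qed

lemma rfun_diagonal: "rfun 1 (\<lambda>xs. LEAST k. Suc (xs ! 0) - triangle (Suc k) = 0)"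
proof -
  have "rfun 1 (\<lambda>xs. LEAST k. Suc ((k # xs) ! 1) - triangle (Suc ((k # xs) ! 0)) = 0)"
  proof (rule rfun_Least)
    \<comment> \<open>Every \<open>z\<close> lies below \<open>triangle (Suc z)\<close>, so the
      search stops at \<open>z\<close> at the latest.\<close>
    show "\<exists>k. Suc ((k # xs) ! 1) - triangle (Suc ((k # xs) ! 0)) = 0" for xs :: "nat list"
      by (intro exI[of _ "xs ! 0"]) simp
  qed (intro rfun_diff rfun_Suc rfun_triangle rfun_proj; simp)
  then show ?thesis by simp
qed

lemma computable_pfst: "computable pfst"
proof -
  have eq: "pfst z = z - triangle (LEAST k. Suc z - triangle (Suc k) = 0)" for z
  proof -
    have "pfst (prod_encode (a, b)) = prod_encode (a, b) - triangle (LEAST k. Suc (prod_encode (a, b)) - triangle (Suc k) = 0)" for a b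
      unfolding Least_triangle pfst_pair by (simp add: prod_encode_def)
    from this[of "pfst z" "psnd z"] show ?thesis by simp
  qed
  have "rfun 1 (\<lambda>xs. xs ! 0 - triangle (LEAST k. Suc (xs ! 0) - triangle (Suc k) = 0))"
    by (intro rfun_diff rfun_triangle rfun_diagonal rfun_proj zero_less_one)
  then show ?thesis unfolding computable_iff_rfun by (simp only: eq)
qed

lemma computable_psnd: "computable psnd"
proof -
  have eq: "psnd z = (LEAST k. Suc z - triangle (Suc k) = 0) - pfst z" for z
  proof -
    have "psnd (prod_encode (a, b)) = (LEAST k. Suc (prod_encode (a, b)) - triangle (Suc k) = 0) - pfst (prod_encode (a, b))" for a b
      unfolding Least_triangle by simp
    from this[of "pfst z" "psnd z"] show ?thesis by simp
  qed
  have "rfun 1 (\<lambda>xs. (LEAST k. Suc (xs ! 0) - triangle (Suc k) = 0) - pfst (xs ! 0))"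
    using computable_pfst unfolding computable_iff_rfun by (intro rfun_diff rfun_diagonal)
  then show ?thesis unfolding computable_iff_rfun by (simp only: eq)
qed

lemma rfun_pair: "rfun n g \<Longrightarrow> rfun n h \<Longrightarrow> rfun n (\<lambda>xs. prod_encode (g xs, h xs))"
  by (simp add: prod_encode_def) (intro rfun_add rfun_triangle)

section \<open>Closure properties of computable functions and decidable predicates\<close>

text \<open>All rules concern unary functions and predicates, with several arguments packed by
  \<open>prod_encode\<close>. Decidability of a formula then follows its syntax: a bound variable
  becomes the second component of a pair.\<close>

named_theorems comp_intros

lemma computable_comp: "computable f \<Longrightarrow> computable g \<Longrightarrow> computable (\<lambda>x. f (g x))"
  unfolding computable_iff_rfun by (rule rfun_comp1)

lemma computable2_comp: "computable2 f \<Longrightarrow> computable g \<Longrightarrow> computable h \<Longrightarrow> computable (\<lambda>x. f (g x) (h x))"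
  unfolding computable_iff_rfun computable2_iff_rfun by (rule rfun_comp2)

lemma computable_basic [comp_intros]:
  "computable (\<lambda>x. x)" "computable (\<lambda>x. k)"
  "computable f \<Longrightarrow> computable (\<lambda>x. Suc (f x))"
  "computable f \<Longrightarrow> computable g \<Longrightarrow> computable (\<lambda>x. f x + g x)"
  "computable f \<Longrightarrow> computable g \<Longrightarrow> computable (\<lambda>x. f x * g x)"
  "computable f \<Longrightarrow> computable g \<Longrightarrow> computable (\<lambda>x. f x - g x)"
  "computable f \<Longrightarrow> computable g \<Longrightarrow> computable (\<lambda>x. prod_encode (f x, g x))"
  unfolding computable_iff_rfun
  by (intro rfun_proj rfun_const rfun_Suc rfun_add rfun_mult rfun_diff rfun_pair; simp)+

lemmas [comp_intros] = computable_comp[OF computable_pfst] computable_comp[OF computable_psnd]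

lemma computable_rec [comp_intros]:
  assumes a: "computable a" and b: "computable (\<lambda>p. b (pfst p) (pfst (psnd p)) (psnd (psnd p)))"
    and h: "computable h"
  shows "computable (\<lambda>x. rec_nat (a x) (b x) (h x))"
proof -
  let ?b = "\<lambda>p. b (pfst p) (pfst (psnd p)) (psnd (psnd p))"
  \<comment> \<open>The recursion scheme supplies \<open>[k, r, x]\<close>, whereas \<open>b\<close>
    reads a packed triple with \<open>x\<close> first.\<close>
  have "rfun (Suc (Suc 1)) (\<lambda>xs. ?b (prod_encode (xs ! 2, prod_encode (xs ! 0, xs ! 1))))"
    by (intro rfun_comp1[OF b[unfolded computable_iff_rfun]] rfun_pair rfun_proj) simp_all
  from rfun_rec[OF a[unfolded computable_iff_rfun] this h[unfolded computable_iff_rfun]]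
  show ?thesis unfolding computable_iff_rfun by simp
qed

definition decP :: "(nat \<Rightarrow> bool) \<Rightarrow> bool" where
  "decP P \<longleftrightarrow> computable (\<lambda>x. of_bool (P x))"

lemma decidable_iff_decP: "decidable {x. P x} \<longleftrightarrow> decP P"
proof -
  have "chi {x. P x} = (\<lambda>x. of_bool (P x))" by (auto simp: chi_def)
  then show ?thesis by (simp add: decidable_def decP_def)
qed

lemma computable_of_bool [comp_intros]: "decP P \<Longrightarrow> computable (\<lambda>x. of_bool (P x))"
  by (simp add: decP_def)

lemma decP_comp: "decP P \<Longrightarrow> computable f \<Longrightarrow> decP (\<lambda>x. P (f x))"
  unfolding decP_def by (rule computable_comp[where f = "\<lambda>y. of_bool (P y)"])

lemma decP_const [comp_intros]: "decP (\<lambda>_. b)"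
  unfolding decP_def by (rule computable_basic(2))

lemma decP_not [comp_intros]: "decP P \<Longrightarrow> decP (\<lambda>x. \<not> P x)"
proof -
  assume "decP P"
  then have "computable (\<lambda>x. 1 - of_bool (P x))" by (intro comp_intros)
  moreover have "(\<lambda>x. 1 - of_bool (P x) :: nat) = (\<lambda>x. of_bool (\<not> P x))" by (auto simp: fun_eq_iff)
  ultimately show ?thesis unfolding decP_def by (simp only:)
qed

lemma decP_conj [comp_intros]: "decP P \<Longrightarrow> decP Q \<Longrightarrow> decP (\<lambda>x. P x \<and> Q x)"
  unfolding decP_def of_bool_conj by (rule computable_basic(5))

lemma decP_disj [comp_intros]: assumes "decP P" "decP Q" shows "decP (\<lambda>x. P x \<or> Q x)"
proof -
  have "decP (\<lambda>x. \<not> (\<not> P x \<and> \<not> Q x))" using assms by (intro comp_intros)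
  then show ?thesis by simp
qed

lemma decP_imp [comp_intros]: assumes "decP P" "decP Q" shows "decP (\<lambda>x. P x \<longrightarrow> Q x)"
  using decP_disj[OF decP_not[OF assms(1)] assms(2)] by simp

lemma decP_le [comp_intros]: assumes "computable f" "computable g" shows "decP (\<lambda>x. f x \<le> g x)"
proof -
  have "computable (\<lambda>x. 1 - (f x - g x))" using assms by (intro comp_intros)
  moreover have "(\<lambda>x. 1 - (f x - g x)) = (\<lambda>x. of_bool (f x \<le> g x))" by (auto simp: fun_eq_iff)
  ultimately show ?thesis unfolding decP_def by (simp only:)
qed

lemma decP_less [comp_intros]: assumes "computable f" "computable g" shows "decP (\<lambda>x. f x < g x)"
  using decP_not[OF decP_le[OF assms(2,1)]] by (simp add: not_le)

lemma decP_eq [comp_intros]: assumes "computable f" "computable g" shows "decP (\<lambda>x. f x = g x)"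
  using decP_conj[OF decP_le[OF assms] decP_le[OF assms(2,1)]]
  by (rule back_subst[of decP]) (auto simp: fun_eq_iff)

lemma decP_ball [comp_intros]:
  assumes "decP (\<lambda>p. P (pfst p) (psnd p))" "computable h"
  shows "decP (\<lambda>x. \<forall>y<h x. P x y)"
proof -
  have "computable (\<lambda>p. prod_encode (pfst p, pfst (psnd p)))" by (intro comp_intros)
  from computable_comp[OF assms(1)[unfolded decP_def] this]
  have "computable (\<lambda>p. of_bool (P (pfst p) (pfst (psnd p))))" by simp
  then have "computable (\<lambda>x. rec_nat 1 (\<lambda>k r. r * of_bool (P x k)) (h x))"
    using assms(2) by (intro computable_rec computable_basic computable_comp[OF computable_pfst] computable_comp[OF computable_psnd])
  moreover have "rec_nat (1::nat) (\<lambda>k r. r * of_bool (P x k)) n = of_bool (\<forall>y<n. P x y)" for x n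
    by (induction n) (auto simp: less_Suc_eq)
  ultimately show ?thesis unfolding decP_def by simp
qed

lemma decP_bex [comp_intros]:
  assumes "decP (\<lambda>p. P (pfst p) (psnd p))" "computable h"
  shows "decP (\<lambda>x. \<exists>y<h x. P x y)"
  using decP_not[OF decP_ball[of "\<lambda>x y. \<not> P x y", OF decP_not[OF assms(1)] assms(2)]] by simp

lemma computable_card [comp_intros]:
  assumes "decP (\<lambda>p. P (pfst p) (psnd p))" "computable h"
  shows "computable (\<lambda>x. card {y. y < h x \<and> P x y})"
proof -
  have "computable (\<lambda>p. prod_encode (pfst p, pfst (psnd p)))" by (intro comp_intros)
  from computable_comp[OF assms(1)[unfolded decP_def] this]
  have "computable (\<lambda>p. of_bool (P (pfst p) (pfst (psnd p))))" by simp
  then have "computable (\<lambda>x. rec_nat 0 (\<lambda>k r. r + of_bool (P x k)) (h x))"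
    using assms(2) by (intro computable_rec computable_basic computable_comp[OF computable_pfst] computable_comp[OF computable_psnd])
  moreover have "rec_nat (0::nat) (\<lambda>k r. r + of_bool (P x k)) n = card {y. y < n \<and> P x y}" for x n
  proof (induction n)
    case (Suc n)
    have "{y. y < Suc n \<and> P x y} = (if P x n then insert n {y. y < n \<and> P x y} else {y. y < n \<and> P x y})"
      by (auto simp: less_Suc_eq)
    then show ?case using Suc by simp
  qed simp
  ultimately show ?thesis by simp
qed

lemma computable_if [comp_intros]:
  assumes "decP P" "computable f" "computable g"
  shows "computable (\<lambda>x. if P x then f x else g x)"
proof -
  have "computable (\<lambda>x. of_bool (P x) * f x + of_bool (\<not> P x) * g x)"
    using assms by (intro comp_intros)
  moreover have "(\<lambda>x. of_bool (P x) * f x + of_bool (\<not> P x) * g x) = (\<lambda>x. if P x then f x else g x)"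
    by (auto simp: fun_eq_iff)
  ultimately show ?thesis by (simp only:)
qed

lemma computable_Least [comp_intros]:
  assumes P: "decP (\<lambda>p. P (pfst p) (psnd p))" and ex: "\<And>x. \<exists>y. P x y"
  shows "computable (\<lambda>x. LEAST y. P x y)"
proof -
  have "computable (\<lambda>p. of_bool (\<not> P (pfst p) (psnd p)))" using P by (intro comp_intros)
  from rfun_comp1[OF this[unfolded computable_iff_rfun], of "Suc 1" "\<lambda>xs. prod_encode (xs ! 1, xs ! 0)"]
  have "rfun (Suc 1) (\<lambda>xs. of_bool (\<not> P (xs ! 1) (xs ! 0)))"
    by (simp add: rfun_pair rfun_proj)
  from rfun_Least[OF this] ex show ?thesis unfolding computable_iff_rfun by simp
qed

lemma decP2_comp:
  assumes "decP (\<lambda>p. P (pfst p) (psnd p))" "computable f" "computable g"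
  shows "decP (\<lambda>x. P (f x) (g x))"
proof -
  have "computable (\<lambda>x. prod_encode (f x, g x))" using assms(2,3) by (intro comp_intros)
  from decP_comp[OF assms(1) this] show ?thesis by simp
qed

lemma computable_comp2:
  assumes "computable (\<lambda>p. h (pfst p) (psnd p))" "computable f" "computable g"
  shows "computable (\<lambda>x. h (f x) (g x))"
proof -
  have "computable (\<lambda>x. prod_encode (f x, g x))" using assms(2,3) by (intro comp_intros)
  from computable_comp[OF assms(1) this] show ?thesis by simp
qed

section \<open>Computable operations on list codes\<close>

declare list_encode.simps(2) [simp del]

definition lcons :: "nat \<Rightarrow> nat \<Rightarrow> nat" where "lcons x l = Suc (prod_encode (x, l))"
definition ltl :: "nat \<Rightarrow> nat" where "ltl l = psnd (l - 1)"
text \<open>Iterating the tail is primitive recursion on codes; length and indexing become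
  computable through it without recursion over lists.\<close>

definition ldrop :: "nat \<Rightarrow> nat \<Rightarrow> nat" where "ldrop l i = rec_nat l (\<lambda>_. ltl) i"
definition lnth :: "nat \<Rightarrow> nat \<Rightarrow> nat" where "lnth l i = pfst (ldrop l i - 1)"
definition llen :: "nat \<Rightarrow> nat" where "llen l = (LEAST i. ldrop l i = 0)"

lemma list_decode_lcons [simp]: "list_decode (lcons x l) = x # list_decode l"
  by (simp add: lcons_def)

lemma lcons_list_encode: "lcons x (list_encode xs) = list_encode (x # xs)"
  by (simp add: lcons_def list_encode.simps)

lemma list_decode_eq_Nil_iff [simp]: "list_decode l = [] \<longleftrightarrow> l = 0"
  by (metis list_decode.simps(1) list_decode_inverse)

lemma list_decode_ltl [simp]: "list_decode (ltl l) = tl (list_decode l)"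
proof (cases l)
  case 0
  have "psnd 0 = 0" by (metis le_zero_eq le_prod_encode_2 pair_eta)
  then show ?thesis using 0 by (simp add: ltl_def)
qed (simp add: ltl_def psnd_def split: prod.split)

lemma list_decode_ldrop [simp]: "list_decode (ldrop l i) = drop i (list_decode l)"
  by (induction i) (simp_all add: ldrop_def tl_drop drop_Suc)

lemma llen_eq [simp]: "llen l = length (list_decode l)"
proof -
  have "ldrop l i = 0 \<longleftrightarrow> length (list_decode l) \<le> i" for i
    unfolding list_decode_eq_Nil_iff[symmetric] list_decode_ldrop by simp
  then show ?thesis unfolding llen_def by (auto intro: Least_equality)
qed

lemma pfst_pred: "l \<noteq> 0 \<Longrightarrow> pfst (l - 1) = hd (list_decode l)"
  by (cases l) (auto simp: pfst_def split: prod.split)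

lemma lnth_eq [simp]:
  assumes "i < length (list_decode l)" shows "lnth l i = list_decode l ! i"
proof -
  have "ldrop l i \<noteq> 0"
    using assms unfolding list_decode_eq_Nil_iff[symmetric] list_decode_ldrop by simp
  then show ?thesis using assms by (simp add: lnth_def pfst_pred hd_drop_conv_nth del: One_nat_def)
qed

lemma computable_lcons [comp_intros]:
  "computable f \<Longrightarrow> computable g \<Longrightarrow> computable (\<lambda>x. lcons (f x) (g x))"
  unfolding lcons_def by (intro comp_intros)

lemma computable_ltl [comp_intros]: "computable f \<Longrightarrow> computable (\<lambda>x. ltl (f x))"
  unfolding ltl_def by (intro comp_intros)

lemma computable_ldrop [comp_intros]:
  "computable f \<Longrightarrow> computable g \<Longrightarrow> computable (\<lambda>x. ldrop (f x) (g x))"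
  unfolding ldrop_def by (intro comp_intros)

lemma computable_lnth [comp_intros]:
  "computable f \<Longrightarrow> computable g \<Longrightarrow> computable (\<lambda>x. lnth (f x) (g x))"
  unfolding lnth_def by (intro comp_intros)

lemma computable_llen [comp_intros]: assumes "computable f" shows "computable (\<lambda>x. llen (f x))"
proof -
  have "\<exists>i. ldrop l i = 0" for l
    by (metis drop_all list_decode_eq_Nil_iff list_decode_ldrop order_refl)
  then have "computable llen" unfolding llen_def[abs_def] by (intro comp_intros) auto
  then show ?thesis using assms by (rule computable_comp)
qed

section \<open>Certificates for inductively defined sets\<close>

text \<open>The premises reach \<open>step\<close> as one list code, so that a rule system is a
  binary relation on numbers whose decidability can be stated.\<close>

inductive derivable :: "(nat \<Rightarrow> nat \<Rightarrow> bool) \<Rightarrow> nat \<Rightarrow> bool" for step where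
  derivableI: "(\<And>y. y \<in> set cs \<Longrightarrow> derivable step y) \<Longrightarrow> step (list_encode cs) x \<Longrightarrow> derivable step x"

text \<open>An entry pairs a conclusion with the code of its premise list. Premises must occur later
  in the certificate, which excludes circular justifications.\<close>

fun certifies :: "(nat \<Rightarrow> nat \<Rightarrow> bool) \<Rightarrow> nat list \<Rightarrow> bool" where
  "certifies step [] \<longleftrightarrow> True"
| "certifies step (a # L) \<longleftrightarrow> step (psnd a) (pfst a) \<and>
     set (list_decode (psnd a)) \<subseteq> pfst ` set L \<and> certifies step L"

lemma certifies_append: "certifies step L \<Longrightarrow> certifies step M \<Longrightarrow> certifies step (L @ M)"
  by (induction L) auto

lemma certifies_sound: "certifies step L \<Longrightarrow> a \<in> set L \<Longrightarrow> derivable step (pfst a)"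
proof (induction L arbitrary: a)
  case (Cons b L)
  have "derivable step (pfst b)"
    by (rule derivableI[of "list_decode (psnd b)"]) (use Cons in auto)
  then show ?case using Cons by auto
qed simp

lemma certifies_complete: "derivable step x \<Longrightarrow> \<exists>L. certifies step L \<and> x \<in> pfst ` set L"
proof (induction rule: derivable.induct)
  case (derivableI cs x)
  have "\<exists>L. certifies step L \<and> set cs \<subseteq> pfst ` set L"
    using derivableI.IH
  proof (induction cs)
    case (Cons y cs)
    obtain L M where "certifies step L" "y \<in> pfst ` set L" "certifies step M" "set cs \<subseteq> pfst ` set M"
      using Cons by (metis list.set_intros)
    then show ?case by (intro exI[of _ "L @ M"]) (auto simp: certifies_append)
  qed (auto intro: exI[of _ "[]"])
  then obtain L where "certifies step L" "set cs \<subseteq> pfst ` set L" by blast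
  then show ?case using derivableI.hyps
    by (intro exI[of _ "prod_encode (x, list_encode cs) # L"]) auto
qed

lemma certifies_iff_nth: "certifies step L \<longleftrightarrow>
  (\<forall>i<length L. step (psnd (L ! i)) (pfst (L ! i)) \<and>
     (\<forall>k<length (list_decode (psnd (L ! i))). \<exists>j<length L. i < j \<and>
        pfst (L ! j) = list_decode (psnd (L ! i)) ! k))"
proof (induction L)
  case (Cons a L)
  have "set ys \<subseteq> pfst ` set L \<longleftrightarrow> (\<forall>k<length ys. \<exists>j<length L. pfst (L ! j) = ys ! k)" for ys
    by (force simp: in_set_conv_nth subset_iff image_iff)
  with Cons show ?case by (simp add: All_less_Suc2 Ex_less_Suc2)
qed simp

text \<open>Every quantifier behind the one over \<open>l\<close> is bounded, so a decidable rule
  system derives a Sigma_1 set.\<close>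

lemma derivable_iff_certificate: "derivable step x \<longleftrightarrow>
  (\<exists>l. (\<forall>i<llen l. step (psnd (lnth l i)) (pfst (lnth l i)) \<and>
     (\<forall>k<llen (psnd (lnth l i)). \<exists>j<llen l. i < j \<and> pfst (lnth l j) = lnth (psnd (lnth l i)) k))
     \<and> (\<exists>i<llen l. pfst (lnth l i) = x))" (is "_ \<longleftrightarrow> (\<exists>l. ?C l \<and> ?D l)")
proof -
  have C: "?C l \<longleftrightarrow> certifies step (list_decode l)" for l
    unfolding certifies_iff_nth by (simp cong: conj_cong)
  have D: "?D l \<longleftrightarrow> x \<in> pfst ` set (list_decode l)" for l
    by (force simp: in_set_conv_nth)
  show ?thesis unfolding C D
    using certifies_sound certifies_complete by (metis imageE list_encode_inverse)
qed

section \<open>The arithmetical hierarchy\<close>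

definition Sg :: "nat \<Rightarrow> (nat \<Rightarrow> bool) \<Rightarrow> bool" where
  "Sg n P \<longleftrightarrow> {x. P x} \<in> Sigma0 n"

lemma Sg_0: "Sg 0 P \<longleftrightarrow> decP P"
  by (simp add: Sg_def decidable_iff_decP)

lemma Sg_Suc: "Sg (Suc n) P \<longleftrightarrow>
  (\<exists>Q. Sg n (\<lambda>z. \<not> Q z) \<and> (\<forall>x. P x \<longleftrightarrow> (\<exists>y. Q (prod_encode (x, y)))))"
proof
  assume "Sg (Suc n) P"
  then obtain S where "- S \<in> Sigma0 n" "{x. P x} = {x. \<exists>y. prod_encode (x, y) \<in> S}"
    by (auto simp: Sg_def)
  then show "\<exists>Q. Sg n (\<lambda>z. \<not> Q z) \<and> (\<forall>x. P x \<longleftrightarrow> (\<exists>y. Q (prod_encode (x, y))))"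
    by (intro exI[of _ "\<lambda>z. z \<in> S"]) (auto simp: Sg_def Compl_eq)
next
  assume "\<exists>Q. Sg n (\<lambda>z. \<not> Q z) \<and> (\<forall>x. P x \<longleftrightarrow> (\<exists>y. Q (prod_encode (x, y))))"
  then obtain Q where "Sg n (\<lambda>z. \<not> Q z)" "\<forall>x. P x \<longleftrightarrow> (\<exists>y. Q (prod_encode (x, y)))" by blast
  then show "Sg (Suc n) P" unfolding Sg_def Sigma0.simps mem_Collect_eq
    by (intro exI[of _ "{z. Q z}"]) (auto simp: Collect_neg_eq)
qed

definition Pg :: "nat \<Rightarrow> (nat \<Rightarrow> bool) \<Rightarrow> bool" where
  "Pg n P \<longleftrightarrow> Sg n (\<lambda>x. \<not> P x)"

lemma Pg_iff: "Pg n P \<longleftrightarrow> {x. P x} \<in> Pi0 n"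
  by (simp add: Pg_def Sg_def Pi0_def Collect_neg_eq)

lemma Sg_Not: "Pg n P \<Longrightarrow> Sg n (\<lambda>x. \<not> P x)" and Pg_Not: "Sg n P \<Longrightarrow> Pg n (\<lambda>x. \<not> P x)"
  by (simp_all add: Pg_def)

lemma Sg_comp: "Sg n P \<Longrightarrow> computable f \<Longrightarrow> Sg n (\<lambda>x. P (f x))"
proof (induction n arbitrary: P f)
  case 0 then show ?case by (simp add: Sg_0 decP_comp)
next
  case (Suc n)
  from Suc.prems(1) obtain Q where Q: "Sg n (\<lambda>z. \<not> Q z)" "\<forall>x. P x \<longleftrightarrow> (\<exists>y. Q (prod_encode (x, y)))"
    by (auto simp: Sg_Suc)
  have "computable (\<lambda>z. prod_encode (f (pfst z), psnd z))"
    using Suc.prems(2) by (intro comp_intros computable_comp[OF Suc.prems(2)])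
  from Suc.IH[OF Q(1) this] Q(2) show ?case
    unfolding Sg_Suc by (intro exI[of _ "\<lambda>z. Q (prod_encode (f (pfst z), psnd z))"]) simp
qed

lemma Pg_comp: "Pg n P \<Longrightarrow> computable f \<Longrightarrow> Pg n (\<lambda>x. P (f x))"
  unfolding Pg_def by (rule Sg_comp)

lemma Sg_Ex_Pg: "Pg n (\<lambda>p. P (pfst p) (psnd p)) \<Longrightarrow> Sg (Suc n) (\<lambda>x. \<exists>y. P x y)"
  unfolding Sg_Suc Pg_def by (intro exI[of _ "\<lambda>p. P (pfst p) (psnd p)"]) simp

lemma Pg_All_Sg: "Sg n (\<lambda>p. P (pfst p) (psnd p)) \<Longrightarrow> Pg (Suc n) (\<lambda>x. \<forall>y. P x y)"
  using Sg_Ex_Pg[of n "\<lambda>x y. \<not> P x y"] by (simp add: Pg_def)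

lemma Sg_Suc_of_Pg: assumes "Pg n P" shows "Sg (Suc n) P"
  using Sg_Ex_Pg[of n "\<lambda>x y. P x"] Pg_comp[OF assms computable_pfst] by simp

text \<open>A dummy quantifier is needed at level 0 alone; above it the matrix is kept and its
  complement is raised one level.\<close>

lemma Sg_Suc_of_Sg: "Sg n P \<Longrightarrow> Sg (Suc n) P"
proof (induction n arbitrary: P)
  case 0
  then have "Pg 0 P" by (simp add: Pg_def Sg_0 comp_intros)
  then show ?case by (rule Sg_Suc_of_Pg)
next
  case (Suc n)
  from Suc.prems obtain Q where "Sg n (\<lambda>z. \<not> Q z)" "\<forall>x. P x \<longleftrightarrow> (\<exists>y. Q (prod_encode (x, y)))"
    by (auto simp: Sg_Suc)
  then show ?case using Suc.IH by (subst Sg_Suc) blast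
qed

lemma Pg_Suc_of_Sg: "Sg n P \<Longrightarrow> Pg (Suc n) P" and Pg_Suc_of_Pg: "Pg n P \<Longrightarrow> Pg (Suc n) P"
  using Sg_Suc_of_Pg[of n "\<lambda>x. \<not> P x"] Sg_Suc_of_Sg[of n "\<lambda>x. \<not> P x"] by (simp_all add: Pg_def)

text \<open>The two claims need each other: the matrix is known through its complement, where
  conjunction and disjunction trade places. A conjunction takes a pair of witnesses, a disjunction
  can share one.\<close>

lemma Sg_conj_disj: "Sg n P \<Longrightarrow> Sg n Q \<Longrightarrow> Sg n (\<lambda>x. P x \<and> Q x) \<and> Sg n (\<lambda>x. P x \<or> Q x)"
proof (induction n arbitrary: P Q)
  case 0 then show ?case by (simp add: Sg_0 comp_intros)
next
  case (Suc n)
  from Suc.prems obtain P' Q' where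
    P': "Sg n (\<lambda>z. \<not> P' z)" "\<And>x. P x \<longleftrightarrow> (\<exists>y. P' (prod_encode (x, y)))" and
    Q': "Sg n (\<lambda>z. \<not> Q' z)" "\<And>x. Q x \<longleftrightarrow> (\<exists>y. Q' (prod_encode (x, y)))"
    unfolding Sg_Suc by blast
  let ?f = "\<lambda>z. prod_encode (pfst z, pfst (psnd z))" and ?g = "\<lambda>z. prod_encode (pfst z, psnd (psnd z))"
  have c: "Sg n (\<lambda>z. \<not> P' (?f z))" "Sg n (\<lambda>z. \<not> Q' (?g z))"
    by (rule Sg_comp[OF P'(1)] Sg_comp[OF Q'(1)]; intro comp_intros)+
  have "Sg n (\<lambda>z. \<not> (P' (?f z) \<and> Q' (?g z)))" "Sg n (\<lambda>z. \<not> (P' z \<or> Q' z))"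
    using Suc.IH[OF c] Suc.IH[OF P'(1) Q'(1)] by simp_all
  moreover have "P x \<and> Q x \<longleftrightarrow> (\<exists>y. P' (?f (prod_encode (x, y))) \<and> Q' (?g (prod_encode (x, y))))" for x
    unfolding P'(2) Q'(2) by (metis pfst_pair psnd_pair)
  moreover have "P x \<or> Q x \<longleftrightarrow> (\<exists>y. P' (prod_encode (x, y)) \<or> Q' (prod_encode (x, y)))" for x
    unfolding P'(2) Q'(2) by blast
  ultimately show ?case unfolding Sg_Suc
    by (intro conjI exI[of _ "\<lambda>z. P' (?f z) \<and> Q' (?g z)"] exI[of _ "\<lambda>z. P' z \<or> Q' z"]) auto
qed

lemma Sg_conj: "Sg n P \<Longrightarrow> Sg n Q \<Longrightarrow> Sg n (\<lambda>x. P x \<and> Q x)"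
  and Sg_disj: "Sg n P \<Longrightarrow> Sg n Q \<Longrightarrow> Sg n (\<lambda>x. P x \<or> Q x)"
  using Sg_conj_disj by blast+

lemma Pg_conj: "Pg n P \<Longrightarrow> Pg n Q \<Longrightarrow> Pg n (\<lambda>x. P x \<and> Q x)"
  unfolding Pg_def de_Morgan_conj by (rule Sg_disj)

lemma Sg_Ex:
  assumes "Sg (Suc n) (\<lambda>p. P (pfst p) (psnd p))" shows "Sg (Suc n) (\<lambda>x. \<exists>y. P x y)"
proof -
  from assms obtain Q where Q: "Sg n (\<lambda>z. \<not> Q z)" "\<And>p. P (pfst p) (psnd p) \<longleftrightarrow> (\<exists>y. Q (prod_encode (p, y)))"
    unfolding Sg_Suc by blast
  have "Sg n (\<lambda>z. \<not> Q (prod_encode (prod_encode (pfst z, pfst (psnd z)), psnd (psnd z))))"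
    by (rule Sg_comp[OF Q(1)]) (intro comp_intros)
  moreover have "(\<exists>y. P x y) \<longleftrightarrow> (\<exists>y. Q (prod_encode (prod_encode (x, pfst y), psnd y)))" for x
    using Q(2)[of "prod_encode (x, _)"] by (metis pfst_pair psnd_pair)
  ultimately show ?thesis unfolding Sg_Suc
    by (intro exI[of _ "\<lambda>z. Q (prod_encode (prod_encode (pfst z, pfst (psnd z)), psnd (psnd z)))"]) simp
qed

lemma Pg_All:
  assumes "Pg (Suc n) (\<lambda>p. P (pfst p) (psnd p))" shows "Pg (Suc n) (\<lambda>x. \<forall>y. P x y)"
  using Sg_Ex[of n "\<lambda>x y. \<not> P x y"] assms by (simp add: Pg_def)

lemma Sg_of_decP: "decP P \<Longrightarrow> Sg n P"
  by (induction n) (auto simp: Sg_0 Sg_Suc_of_Sg)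

text \<open>Witnesses for the finitely many instances are collected in one list code.\<close>
lemma Sg_1_ball:
  assumes "Sg 1 (\<lambda>p. P (pfst p) (psnd p))" "computable h"
  shows "Sg 1 (\<lambda>x. \<forall>i<h x. P x i)"
proof -
  from assms obtain Q where Q: "decP Q" "\<And>p. P (pfst p) (psnd p) \<longleftrightarrow> (\<exists>y. Q (prod_encode (p, y)))"
    unfolding One_nat_def Sg_Suc Sg_0 using decP_not by fastforce
  have P: "P x i \<longleftrightarrow> (\<exists>y. Q (prod_encode (prod_encode (x, i), y)))" for x i
    using Q(2)[of "prod_encode (x, i)"] by simp
  have "(\<forall>i<n. P x i) \<longleftrightarrow> (\<exists>l. \<forall>i<n. Q (prod_encode (prod_encode (x, i), lnth l i)))" for x n
  proof
    assume "\<forall>i<n. P x i"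
    then obtain w where w: "\<forall>i<n. Q (prod_encode (prod_encode (x, i), w i))" unfolding P by metis
    then show "\<exists>l. \<forall>i<n. Q (prod_encode (prod_encode (x, i), lnth l i))"
      by (intro exI[of _ "list_encode (map w [0..<n])"]) simp
  qed (auto simp: P)
  moreover have "decP (\<lambda>p. \<forall>i<h (pfst p). Q (prod_encode (prod_encode (pfst p, i), lnth (psnd p) i)))"
    by (intro comp_intros decP_comp[OF Q(1)] computable_comp[OF assms(2)])
  ultimately show ?thesis unfolding One_nat_def by (simp only:) (intro Sg_Ex Sg_of_decP)
qed

lemma Sg_1_derivable:
  assumes "decP (\<lambda>p. step (pfst p) (psnd p))" shows "Sg 1 (derivable step)"
  unfolding derivable_iff_certificate One_nat_def
  by (intro Sg_Ex Sg_of_decP comp_intros decP2_comp[OF assms])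

section \<open>A universal recursively enumerable predicate\<close>

lemma code_inject: "code c = code d \<Longrightarrow> c = d"
proof (induction c arbitrary: d)
  case (Cf f gs)
  then obtain f' gs' where d: "d = Cf f' gs'" by (cases d) auto
  have eq: "code f = code f'" "map code gs = map code gs'"
    using Cf.prems by (simp_all add: d list_encode_eq)
  have "gs = gs'"
  proof (rule nth_equalityI)
    show "length gs = length gs'" using eq(2) by (rule map_eq_imp_length_eq)
    fix i assume i: "i < length gs"
    then have "code (gs ! i) = code (gs' ! i)" using eq(2) by (metis length_map nth_map)
    then show "gs ! i = gs' ! i" using Cf.IH(2) i by simp
  qed
  then show ?case using Cf.IH(1) eq(1) d by simp
next
  case (Rf f g) then show ?case by (cases d) auto
next
  case (Mf f) then show ?case by (cases d) auto
qed (case_tac d; simp)+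

lemma decode_code [simp]: "decode (code c) = c"
  unfolding decode_def by (auto intro: inv_f_f injI code_inject)

text \<open>A rule system for the range of \<open>code\<close>, with the immediate subprograms as
  premises. For tag 3 the second component is already a list code, so prefixing the outer program
  yields the premise list.\<close>

definition code_step :: "nat \<Rightarrow> nat \<Rightarrow> bool" where
  "code_step c e \<longleftrightarrow>
     (pfst e = 0 \<or> pfst e = 1 \<or> pfst e = 6) \<and> psnd e = 0 \<or> pfst e = 2 \<or>
     pfst e = 3 \<and> c = lcons (pfst (psnd e)) (psnd (psnd e)) \<or>
     pfst e = 4 \<and> c = lcons (pfst (psnd e)) (lcons (psnd (psnd e)) 0) \<or>
     pfst e = 5 \<and> c = lcons (psnd e) 0"

lemma decP_code_step: "decP (\<lambda>p. code_step (pfst p) (psnd p))"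
  unfolding code_step_def by (intro comp_intros)

lemma derivable_code_step_iff: "derivable code_step e \<longleftrightarrow> e \<in> range code"
proof
  assume "derivable code_step e"
  then show "e \<in> range code"
  proof (induction rule: derivable.induct)
    case (derivableI cs e)
    have e: "e = prod_encode (pfst e, psnd e)" "psnd e = prod_encode (pfst (psnd e), psnd (psnd e))"
      by simp_all
    have cs: "x \<in> range code" if "list_encode cs = l" "x \<in> set (list_decode l)" for x l
      using derivableI.IH that by auto
    have "code_step (list_encode cs) e" by (rule derivableI.hyps)
    then consider "pfst e = 0" "psnd e = 0" | "pfst e = 1" "psnd e = 0"
      | "pfst e = 6" "psnd e = 0" | "pfst e = 2"
      | "pfst e = 3" "list_encode cs = lcons (pfst (psnd e)) (psnd (psnd e))"
      | "pfst e = 4" "list_encode cs = lcons (pfst (psnd e)) (lcons (psnd (psnd e)) 0)"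
      | "pfst e = 5" "list_encode cs = lcons (psnd e) 0"
      unfolding code_step_def by metis
    then show ?case
    proof cases
      case 1 then have "e = code Zf" using e by simp
      then show ?thesis by blast
    next
      case 2 then have "e = code Sf" using e by simp
      then show ?thesis by blast
    next
      case 3 then have "e = code Of" using e by simp
      then show ?thesis by blast
    next
      case 4 then have "e = code (Pf (psnd e))" using e by simp
      then show ?thesis by blast
    next
      case 5
      obtain f where f: "pfst (psnd e) = code f" using cs[OF 5(2), of "pfst (psnd e)"] by auto
      have "\<forall>y\<in>set (list_decode (psnd (psnd e))). \<exists>g. y = code g" using cs[OF 5(2)] by auto
      then obtain gs where "list_decode (psnd (psnd e)) = map code gs"
        using ex_map_conv[of _ code] by blast
      then have "psnd (psnd e) = list_encode (map code gs)" by (metis list_decode_inverse)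
      then have "e = code (Cf f gs)" using e f 5(1) by simp
      then show ?thesis by blast
    next
      case 6
      obtain f g where "pfst (psnd e) = code f" "psnd (psnd e) = code g"
        using cs[OF 6(2), of "pfst (psnd e)"] cs[OF 6(2), of "psnd (psnd e)"] by auto
      then have "e = code (Rf f g)" using e 6(1) by simp
      then show ?thesis by blast
    next
      case 7
      obtain f where "psnd e = code f" using cs[OF 7(2), of "psnd e"] by auto
      then have "e = code (Mf f)" using e 7(1) by simp
      then show ?thesis by blast
    qed
  qed
next
  have "derivable code_step (code c)" for c
  proof (induction c)
    case (Cf f gs)
    show ?case
      by (rule derivableI[of "code f # map code gs"])
        (use Cf in \<open>auto simp: code_step_def lcons_list_encode\<close>)
  next
    case (Rf f g)
    show ?case
      by (rule derivableI[of "[code f, code g]"])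
        (use Rf in \<open>auto simp: code_step_def lcons_def list_encode.simps\<close>)
  next
    case (Mf f)
    show ?case
      by (rule derivableI[of "[code f]"])
        (use Mf in \<open>auto simp: code_step_def lcons_def list_encode.simps\<close>)
  qed (rule derivableI[of "[]"]; simp add: code_step_def)+
  then show "e \<in> range code \<Longrightarrow> derivable code_step e" by auto
qed

section \<open>Derivations of evaluation judgments\<close>

abbreviation judg :: "nat \<Rightarrow> nat \<Rightarrow> nat \<Rightarrow> nat" where
  "judg e l v \<equiv> prod_encode (e, prod_encode (l, v))"

text \<open>\<open>c\<close> lists the premises of the judgment \<open>(e, l, v)\<close>, where \<open>t\<close> and \<open>a\<close> are the components of
  \<open>e\<close>. The case \<open>t = 4\<close> of recursion argument \<open>0\<close> does not check that \<open>psnd a\<close> is a code, which is why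
  \<open>Ev\<close> below requires \<open>e \<in> range code\<close> separately.\<close>
definition eval_step :: "nat \<Rightarrow> nat \<Rightarrow> nat \<Rightarrow> nat \<Rightarrow> nat \<Rightarrow> nat \<Rightarrow> bool" where
  "eval_step c e t a l v \<longleftrightarrow>
     t = 0 \<and> v = 0 \<or>
     t = 1 \<and> 0 < llen l \<and> v = Suc (lnth l 0) \<or>
     t = 2 \<and> a < llen l \<and> v = lnth l a \<or>
     t = 3 \<and> llen c = Suc (llen (psnd a)) \<and> (let q = lnth c 0; ys = pfst (psnd q) in
       pfst q = pfst a \<and> psnd (psnd q) = v \<and>
       llen ys = llen (psnd a) \<and>
       (\<forall>i<llen (psnd a). lnth c (Suc i) = judg (lnth (psnd a) i) l (lnth ys i))) \<or>
     t = 4 \<and> 0 < llen l \<and> lnth l 0 = 0 \<and> 0 < llen c \<and> lnth c 0 = judg (pfst a) (ltl l) v \<or>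
     t = 4 \<and> 0 < llen l \<and> 0 < lnth l 0 \<and> 1 < llen c \<and>
       (let q = lnth c 0; n = lnth l 0 - 1 in
         pfst q = e \<and> pfst (psnd q) = lcons n (ltl l) \<and>
         lnth c 1 = judg (psnd a) (lcons n (lcons (psnd (psnd q)) (ltl l))) v) \<or>
     t = 5 \<and> llen c = Suc v \<and> lnth c v = judg a (lcons v l) 0 \<and>
       (\<forall>m<v. let q = lnth c m in pfst q = a \<and> pfst (psnd q) = lcons m l \<and> 0 < psnd (psnd q)) \<or>
     t = 6 \<and> 0 < llen l \<and> v = 0"

definition eval_rule :: "nat \<Rightarrow> nat \<Rightarrow> bool" where
  "eval_rule c j \<longleftrightarrow>
     eval_step c (pfst j) (pfst (pfst j)) (psnd (pfst j)) (pfst (psnd j)) (psnd (psnd j))"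

lemma decP_eval_rule: "decP (\<lambda>p. eval_rule (pfst p) (psnd p))"
  unfolding eval_rule_def eval_step_def Let_def by (intro comp_intros)

text \<open>Generalizing over \<open>r\<close> lets the induction hypothesis be applied to
  subprograms, which the premises name only by their codes.\<close>

lemma derivable_eval_rule_sound:
  "derivable eval_rule j \<Longrightarrow> code r = pfst j \<Longrightarrow> ev r (list_decode (pfst (psnd j))) (psnd (psnd j))"
proof (induction arbitrary: r rule: derivable.induct)
  case (derivableI cs j)
  define l v c where "l = pfst (psnd j)" and "v = psnd (psnd j)" and "c = list_encode cs"
  have prem: "ev q (list_decode (pfst (psnd (lnth c i)))) (psnd (psnd (lnth c i)))"
    if "i < length cs" "pfst (lnth c i) = code q" for q i
    using derivableI.IH[OF nth_mem[OF that(1)], of q] that by (simp add: c_def)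
  have prem': "ev q (list_decode l') v'" if "i < length cs" "lnth c i = judg (code q) l' v'" for q i l' v'
    using prem[OF that(1), of q] that(2) by simp
  have "eval_rule c j" unfolding c_def by (rule derivableI.hyps)
  then have step: "eval_step c (code r) (pfst (code r)) (psnd (code r)) l v"
    by (simp add: eval_rule_def derivableI.prems l_def v_def)
  have len: "llen c = length cs" by (simp add: c_def)
  have "ev r (list_decode l) v"
  proof (cases r)
    case Zf then show ?thesis using step by (auto simp: eval_step_def intro: ev_Z)
  next
    case Sf
    then have "0 < length (list_decode l)" "v = Suc (list_decode l ! 0)"
      using step by (auto simp: eval_step_def)
    then show ?thesis using Sf by (cases "list_decode l") (auto intro: ev_S simp del: list_decode_eq_Nil_iff)
  next
    case (Pf i) then show ?thesis using step by (auto simp: eval_step_def intro: ev_P)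
  next
    case (Cf f gs)
    define ys where "ys = pfst (psnd (lnth c 0))"
    have st: "length cs = Suc (length gs)" "pfst (lnth c 0) = code f" "psnd (psnd (lnth c 0)) = v"
      "length (list_decode ys) = length gs"
      "\<And>i. i < length gs \<Longrightarrow> lnth c (Suc i) = judg (code (gs ! i)) l (list_decode ys ! i)"
      using step unfolding eval_step_def len by (auto simp: Cf Let_def ys_def)
    have "ev f (list_decode ys) v" using prem[OF _ st(2)] by (simp add: st(1,3) ys_def)
    moreover have "list_all2 (\<lambda>g y. ev g (list_decode l) y) gs (list_decode ys)"
      unfolding list_all2_conv_all_nth using st(1,4) prem'[OF _ st(5)] by simp
    ultimately show ?thesis unfolding Cf by (intro ev_C)
  next
    case (Rf f g)
    have l: "0 < length (list_decode l)" using step by (auto simp: eval_step_def Rf)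
    then obtain n ns where n: "list_decode l = n # ns"
      by (metis length_greater_0_conv list.exhaust)
    then have ns: "list_decode (ltl l) = ns" by simp
    show ?thesis
    proof (cases n)
      case 0
      have "0 < length cs" "lnth c 0 = judg (code f) (ltl l) v"
        using step n 0 unfolding eval_step_def len by (auto simp: Rf)
      then have "ev f ns v" using prem' ns by metis
      then show ?thesis unfolding Rf n 0 by (rule ev_R0)
    next
      case (Suc m)
      define y where "y = psnd (psnd (lnth c 0))"
      have st: "1 < length cs" "pfst (lnth c 0) = code (Rf f g)"
        "pfst (psnd (lnth c 0)) = lcons m (ltl l)"
        "lnth c 1 = judg (code g) (lcons m (lcons y (ltl l))) v"
        using step n Suc unfolding eval_step_def len by (auto simp: Rf Let_def y_def)
      have "ev (Rf f g) (m # ns) y" using prem[OF less_trans[OF zero_less_one st(1)] st(2)] st(3) n by (simp add: y_def)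
      moreover have "ev g (m # y # ns) v" using prem'[OF st(1,4)] n by simp
      ultimately show ?thesis unfolding Rf n Suc by (rule ev_RS)
    qed
  next
    case (Mf f)
    have st: "length cs = Suc v" "lnth c v = judg (code f) (lcons v l) 0"
      "\<And>m. m < v \<Longrightarrow> pfst (lnth c m) = code f \<and> pfst (psnd (lnth c m)) = lcons m l \<and> 0 < psnd (psnd (lnth c m))"
      using step unfolding eval_step_def len by (auto simp: Mf Let_def)
    have "ev f (v # list_decode l) 0" using prem'[OF _ st(2)] st(1) by simp
    moreover have "\<exists>y. ev f (m # list_decode l) y \<and> y \<noteq> 0" if m: "m < v" for m
      using prem[of m f] st(1) st(3)[OF m] m by auto
    ultimately show ?thesis unfolding Mf by (intro ev_M) auto
  next
    case Of
    then have "0 < length (list_decode l)" "v = 0" using step by (auto simp: eval_step_def)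
    moreover from this obtain x ns where "list_decode l = x # ns"
      by (metis length_greater_0_conv list.exhaust)
    ultimately show ?thesis using Of ev_O[of no_oracle x ns] by (simp add: no_oracle_def)
  qed
  then show ?case by (simp add: l_def v_def)
qed

lemma derivable_eval_rule_complete: "ev r xs v \<Longrightarrow> derivable eval_rule (judg (code r) (list_encode xs) v)"
proof (induction rule: eval.induct)
  case (ev_Z xs)
  show ?case by (rule derivableI[of "[]"]) (auto simp: eval_rule_def eval_step_def)
next
  case (ev_S x xs)
  show ?case by (rule derivableI[of "[]"]) (auto simp: eval_rule_def eval_step_def)
next
  case (ev_P i xs)
  show ?case
    by (rule derivableI[of "[]"]) (use ev_P in \<open>auto simp: eval_rule_def eval_step_def\<close>)
next
  case (ev_C xs gs ys f z)
  let ?cs = "judg (code f) (list_encode ys) z #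
    map (\<lambda>i. judg (code (gs ! i)) (list_encode xs) (ys ! i)) [0..<length gs]"
  show ?case
  proof (rule derivableI[of ?cs])
    show "derivable eval_rule y" if "y \<in> set ?cs" for y
      using that ev_C.IH by (auto simp: list_all2_conv_all_nth)
    have "length gs = length ys" using ev_C.IH(1) by (auto simp: list_all2_conv_all_nth)
    then show "eval_rule (list_encode ?cs) (judg (code (Cf f gs)) (list_encode xs) z)"
      by (simp add: eval_rule_def eval_step_def Let_def)
  qed
next
  case (ev_R0 f xs y g)
  show ?case
    by (rule derivableI[of "[judg (code f) (list_encode xs) y]"])
      (use ev_R0.IH in \<open>auto simp: eval_rule_def eval_step_def list_encode.simps ltl_def\<close>)
next
  case (ev_RS f g n xs y z)
  have ltl: "ltl (list_encode (Suc n # xs)) = list_encode xs" by (simp add: ltl_def list_encode.simps)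
  show ?case
    by (rule derivableI[of "[judg (code (Rf f g)) (list_encode (n # xs)) y, judg (code g) (list_encode (n # y # xs)) z]"])
      (use ev_RS.IH in \<open>auto simp: eval_rule_def eval_step_def Let_def ltl lcons_list_encode\<close>)
next
  case (ev_M f n xs)
  then obtain w where w: "\<And>m. m < n \<Longrightarrow> derivable eval_rule (judg (code f) (list_encode (m # xs)) (w m)) \<and> w m \<noteq> 0"
    by metis
  \<comment> \<open>Premise number \<open>m\<close> is the run on \<open>m\<close>; the last one,
    number \<open>n\<close>, carries the value 0.\<close>
  let ?cs = "map (\<lambda>m. judg (code f) (list_encode (m # xs)) (w m)) [0..<n] @ [judg (code f) (list_encode (n # xs)) 0]"
  show ?case
  proof (rule derivableI[of ?cs])
    show "derivable eval_rule y" if "y \<in> set ?cs" for y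
      using that w ev_M.IH(1) by auto
    show "eval_rule (list_encode ?cs) (judg (code (Mf f)) (list_encode xs) n)"
      using w by (simp add: eval_rule_def eval_step_def Let_def nth_append lcons_list_encode)
  qed
next
  case (ev_O x xs)
  show ?case by (rule derivableI[of "[]"]) (auto simp: eval_rule_def eval_step_def no_oracle_def)
qed

text \<open>Restricting to genuine codes loses no index of a structure: \<open>decode\<close> sends
  all other numbers to \<open>Zf\<close>, whose relation is empty and hence not reflexive.\<close>

definition Ev :: "nat \<Rightarrow> nat \<Rightarrow> nat \<Rightarrow> nat \<Rightarrow> bool" where
  "Ev e x y v \<longleftrightarrow> e \<in> range code \<and> ev (decode e) [x, y] v"

lemma Ev_iff_derivable: "Ev e x y v \<longleftrightarrow> derivable code_step e \<and>
    derivable eval_rule (judg e (lcons x (lcons y 0)) v)"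
proof -
  have l: "lcons x (lcons y 0) = list_encode [x, y]" by (simp add: lcons_def list_encode.simps)
  have r: "ev r [x, y] v \<longleftrightarrow> derivable eval_rule (judg (code r) (list_encode [x, y]) v)" for r
  proof
    assume "derivable eval_rule (judg (code r) (list_encode [x, y]) v)"
    from derivable_eval_rule_sound[OF this, of r] show "ev r [x, y] v" by simp
  qed (rule derivable_eval_rule_complete)
  show ?thesis unfolding Ev_def derivable_code_step_iff l
  proof (rule conj_cong[OF refl])
    assume "e \<in> range code"
    then obtain r where "e = code r" by blast
    then show "ev (decode e) [x, y] v \<longleftrightarrow> derivable eval_rule (judg e (list_encode [x, y]) v)"
      by (simp only: decode_code r)
  qed
qed

lemma Sg_1_Ev:
  assumes "computable e" "computable x" "computable y" "computable v"
  shows "Sg 1 (\<lambda>p. Ev (e p) (x p) (y p) (v p))"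
  unfolding Ev_iff_derivable
proof (rule Sg_conj)
  show "Sg 1 (\<lambda>p. derivable code_step (e p))"
    by (rule Sg_comp[OF Sg_1_derivable[OF decP_code_step] assms(1)])
  have "computable (\<lambda>p. judg (e p) (lcons (x p) (lcons (y p) 0)) (v p))"
    using assms by (intro comp_intros)
  then show "Sg 1 (\<lambda>p. derivable eval_rule (judg (e p) (lcons (x p) (lcons (y p) 0)) (v p)))"
    by (rule Sg_comp[OF Sg_1_derivable[OF decP_eval_rule]])
qed

text \<open>Diagonalization: \<open>d\<close> searches for a zero of a function that ignores the
  search variable, so it halts on \<open>x\<close> exactly when \<open>x\<close> is outside the
  halting set.\<close>

lemma halting_set_undecidable: "\<not> decidable halting_set"
proof
  assume "decidable halting_set"
  then obtain c where c: "\<And>x. ev c [x] (chi halting_set x)"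
    unfolding decidable_def computable_def computable_in_def by blast
  define d where "d = Mf (Cf c [Pf 1])"
  have c': "ev (Cf c [Pf 1]) [n, x] (chi halting_set x)" for n x
    by (rule ev_C[of _ _ _ "[x]"]) (use c ev_P[of 1 "[n, x]"] in auto)
  show False
  proof (cases "code d \<in> halting_set")
    case True
    then obtain n where "ev d [code d] n" by (auto simp: halting_set_def)
    then have "ev (Cf c [Pf 1]) [n, code d] 0" unfolding d_def by (cases) auto
    from eval_deterministic[OF this c'] show False using True by (simp add: chi_def)
  next
    case False
    have "ev (Cf c [Pf 1]) [0, code d] 0" using c'[of 0 "code d"] False by (simp add: chi_def)
    then have "ev d [code d] 0" unfolding d_def by (rule ev_M) simp
    then show False using False by (auto simp: halting_set_def)
  qed
qed

section \<open>Embeddings of equivalence structures\<close>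

definition cls :: "nat set \<Rightarrow> (nat \<Rightarrow> nat \<Rightarrow> bool) \<Rightarrow> nat \<Rightarrow> nat set" where
  "cls U E x = {y \<in> U. E x y}"

text \<open>\<open>card\<close> is 0 on infinite sets, hence the separate disjunct.\<close>

definition at_least :: "nat \<Rightarrow> nat set \<Rightarrow> bool" where
  "at_least n C \<longleftrightarrow> infinite C \<or> n \<le> card C"

text \<open>Classes are counted through finite sets of representatives, which can be moved along
  embeddings and coded as lists.\<close>

definition indep :: "nat set \<Rightarrow> (nat \<Rightarrow> nat \<Rightarrow> bool) \<Rightarrow> nat set \<Rightarrow> bool" where
  "indep U E I \<longleftrightarrow> I \<subseteq> U \<and> finite I \<and> (\<forall>x\<in>I. \<forall>y\<in>I. E x y \<longrightarrow> x = y)"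

definition inf_cls_ge :: "nat set \<Rightarrow> (nat \<Rightarrow> nat \<Rightarrow> bool) \<Rightarrow> nat \<Rightarrow> bool" where
  "inf_cls_ge U E k \<longleftrightarrow> (\<exists>I. card I = k \<and> indep U E I \<and> (\<forall>x\<in>I. infinite (cls U E x)))"

definition large_cls_ge :: "nat set \<Rightarrow> (nat \<Rightarrow> nat \<Rightarrow> bool) \<Rightarrow> nat \<Rightarrow> bool" where
  "large_cls_ge U E k \<longleftrightarrow> (\<forall>n. \<exists>I. card I = k \<and> indep U E I \<and> (\<forall>x\<in>I. at_least n (cls U E x)))"

text \<open>The cover \<open>R\<close> may contain elements of small classes as well; this makes the
  property easy to pull back along embeddings.\<close>

definition few_above :: "nat set \<Rightarrow> (nat \<Rightarrow> nat \<Rightarrow> bool) \<Rightarrow> nat \<Rightarrow> bool" where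
  "few_above U E m \<longleftrightarrow>
     (\<exists>R. finite R \<and> R \<subseteq> U \<and> (\<forall>x\<in>U. at_least m (cls U E x) \<longrightarrow> (\<exists>y\<in>R. E x y)))"

text \<open>The rank of \<open>x\<close> inside its class. It refers only to numbers below
  \<open>x\<close>, so it is computable in a computable structure.\<close>

definition pos :: "nat set \<Rightarrow> (nat \<Rightarrow> nat \<Rightarrow> bool) \<Rightarrow> nat \<Rightarrow> nat" where
  "pos U E x = card {y. y < x \<and> y \<in> U \<and> E x y}"

lemma equivalence_structure_iff: "equivalence_structure U E \<longleftrightarrow>
  (\<forall>x\<in>U. E x x) \<and> (\<forall>x\<in>U. \<forall>y\<in>U. E x y \<longrightarrow> E y x) \<and>
  (\<forall>x\<in>U. \<forall>y\<in>U. \<forall>z\<in>U. E x y \<longrightarrow> E y z \<longrightarrow> E x z)" (is "_ \<longleftrightarrow> ?R")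
proof
  let ?r = "{(x, y). x \<in> U \<and> y \<in> U \<and> E x y}"
  assume "equivalence_structure U E"
  then have r: "equiv U ?r" by (simp add: equivalence_structure_def)
  show ?R
  proof (intro conjI ballI impI)
    fix x assume x: "x \<in> U"
    have "refl_on U ?r" using r by (rule equivE)
    from refl_onD[OF this x] show "E x x" by simp
    fix y assume y: "y \<in> U" "E x y"
    have "sym ?r" using r by (rule equivE)
    from symD[OF this, of x y] show "E y x" using x y by simp
    fix z assume z: "z \<in> U" "E y z"
    have "trans ?r" using r by (rule equivE)
    from transD[OF this, of x y z] show "E x z" using x y z by simp
  qed
next
  assume R: ?R
  show "equivalence_structure U E" unfolding equivalence_structure_def
  proof (intro equivI refl_onI symI transI)
    fix x y z assume "(x, y) \<in> {(x, y). x \<in> U \<and> y \<in> U \<and> E x y}" "(y, z) \<in> {(x, y). x \<in> U \<and> y \<in> U \<and> E x y}"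
    then show "(x, z) \<in> {(x, y). x \<in> U \<and> y \<in> U \<and> E x y}" using R by blast
  qed (use R in blast)+
qed

lemma card_below_less:
  assumes "a \<in> C" "a \<in> D" "finite D" "{z \<in> C. z < a} \<subseteq> D"
  shows "card {z \<in> C. z < (a::nat)} < card D"
proof (rule psubset_card_mono[OF assms(3)])
  have "a \<notin> {z \<in> C. z < a}" by simp
  then show "{z \<in> C. z < a} \<subset> D" using assms(2,4) by blast
qed

context
  fixes U E assumes eq: "equivalence_structure U E"
begin

lemma eqs_refl: "x \<in> U \<Longrightarrow> E x x"
  and eqs_sym: "E x y \<Longrightarrow> x \<in> U \<Longrightarrow> y \<in> U \<Longrightarrow> E y x"
  and eqs_trans: "E x y \<Longrightarrow> E y z \<Longrightarrow> x \<in> U \<Longrightarrow> y \<in> U \<Longrightarrow> z \<in> U \<Longrightarrow> E x z"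
  using eq unfolding equivalence_structure_iff by blast+

lemma cls_eq_iff: "x \<in> U \<Longrightarrow> y \<in> U \<Longrightarrow> cls U E x = cls U E y \<longleftrightarrow> E x y"
proof
  assume "x \<in> U" "y \<in> U" "cls U E x = cls U E y"
  then show "E x y" using eqs_refl[of y] unfolding cls_def by blast
next
  assume xy: "x \<in> U" "y \<in> U" "E x y"
  have "E x z \<longleftrightarrow> E y z" if "z \<in> U" for z
    using eqs_trans[OF xy(3) _ xy(1,2) that] eqs_trans[OF eqs_sym[OF xy(3,1,2)] _ xy(2,1) that] by blast
  then show "cls U E x = cls U E y" unfolding cls_def by blast
qed

lemma pos_cls: "pos U E x = card {y \<in> cls U E x. y < x}"
  unfolding pos_def cls_def by (rule arg_cong[of _ _ card]) auto

lemma at_least_Suc_pos: assumes "x \<in> U" shows "at_least (Suc (pos U E x)) (cls U E x)"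
proof (cases "finite (cls U E x)")
  case True
  have "x \<in> cls U E x" using eqs_refl[OF assms] assms by (simp add: cls_def)
  then have "card {y \<in> cls U E x. y < x} < card (cls U E x)"
    using True by (intro card_below_less) auto
  then show ?thesis by (simp add: at_least_def pos_cls)
qed (simp add: at_least_def)

lemma pos_inject:
  assumes "x \<in> U" "y \<in> U" "E x y" "pos U E x = pos U E y" shows "x = y"
proof -
  have mem: "x \<in> cls U E y" "y \<in> cls U E y" and eq: "cls U E x = cls U E y"
    using assms(1,2,3) eqs_refl[OF assms(2)] eqs_sym[OF assms(3,1,2)] cls_eq_iff[OF assms(1,2)]
    by (simp_all add: cls_def)
  have less: "card {z \<in> cls U E y. z < a} < card {z \<in> cls U E y. z < b}"
    if "a \<in> cls U E y" "a < b" for a b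
    by (rule card_below_less) (use that in auto)
  show ?thesis
    using less[OF mem(1), of y] less[OF mem(2), of x] assms(4) unfolding pos_cls eq
    by (cases x y rule: linorder_cases) auto
qed

lemma indep_insert:
  assumes I: "indep U E I" and x: "x \<in> U" "\<forall>y\<in>I. \<not> E x y"
  shows "indep U E (insert x I)" "card (insert x I) = Suc (card I)"
proof -
  have "I \<subseteq> U" "finite I" and inj: "\<And>a b. a \<in> I \<Longrightarrow> b \<in> I \<Longrightarrow> E a b \<Longrightarrow> a = b"
    using I unfolding indep_def by blast+
  have not: "x \<notin> I" using x eqs_refl by blast
  then show "card (insert x I) = Suc (card I)" using \<open>finite I\<close> by simp
  have "\<not> E y x" if "y \<in> I" for y using x eqs_sym[of y x] that \<open>I \<subseteq> U\<close> by blast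
  then have "a = b" if "a \<in> insert x I" "b \<in> insert x I" "E a b" for a b
    using that x(2) inj by blast
  then show "indep U E (insert x I)"
    unfolding indep_def using \<open>I \<subseteq> U\<close> \<open>finite I\<close> x(1) by simp
qed

text \<open>By assumption finitely many representatives never cover all classes of size at least
  \<open>n\<close>, so they can always be extended by one more.\<close>

lemma large_cls_ge_of_not_few_above:
  assumes "\<And>m. \<not> few_above U E m" shows "large_cls_ge U E k"
  unfolding large_cls_ge_def
proof
  fix n
  show "\<exists>I. card I = k \<and> indep U E I \<and> (\<forall>x\<in>I. at_least n (cls U E x))"
  proof (induction k)
    case 0 then show ?case by (intro exI[of _ "{}"]) (simp add: indep_def)
  next
    case (Suc k)
    then obtain I where I: "card I = k" "indep U E I" "\<forall>x\<in>I. at_least n (cls U E x)" by blast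
    then have "finite I" "I \<subseteq> U" by (simp_all add: indep_def)
    with assms[of n] obtain x where x: "x \<in> U" "at_least n (cls U E x)" "\<forall>y\<in>I. \<not> E x y"
      unfolding few_above_def by metis
    show ?case
      by (rule exI[of _ "insert x I"]) (use indep_insert[OF I(2) x(1,3)] I(1,3) x(2) in simp)
  qed
qed

end

section \<open>Invariants carried along embeddings\<close>

lemma embeddingD:
  assumes "embedding f U E V F"
  shows "inj_on f U" "x \<in> U \<Longrightarrow> f x \<in> V" "x \<in> U \<Longrightarrow> y \<in> U \<Longrightarrow> F (f x) (f y) \<longleftrightarrow> E x y"
  using assms unfolding embedding_def by blast+

lemma at_least_mono: "at_least n C \<Longrightarrow> m \<le> n \<Longrightarrow> at_least m C"
  by (auto simp: at_least_def)

lemma at_least_inj: assumes "at_least n C" "inj_on f C" "f ` C \<subseteq> D" shows "at_least n D"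
proof (cases "finite D")
  case True
  then have "finite C" using assms(2,3) by (rule inj_on_finite[rotated 2])
  then show ?thesis using assms card_inj_on_le[OF assms(2,3) True] by (simp add: at_least_def)
qed (simp add: at_least_def)

lemma embedding_cls:
  assumes "embedding f U E V F" "x \<in> U"
  shows "inj_on f (cls U E x)" "f ` cls U E x \<subseteq> cls V F (f x)"
  using embeddingD[OF assms(1)] assms(2) by (auto simp: cls_def inj_on_def)

lemma embedding_at_least:
  assumes "embedding f U E V F" "x \<in> U" "at_least n (cls U E x)" shows "at_least n (cls V F (f x))"
  using at_least_inj[OF assms(3) embedding_cls[OF assms(1,2)]] .

lemma embedding_infinite:
  assumes "embedding f U E V F" "x \<in> U" "infinite (cls U E x)" shows "infinite (cls V F (f x))"
  using embedding_cls[OF assms(1,2)] assms(3) inj_on_finite by blast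

lemma embedding_indep:
  assumes "embedding f U E V F" "indep U E I" shows "indep V F (f ` I)" "card (f ` I) = card I"
proof -
  have "inj_on f I" using embeddingD(1)[OF assms(1)] assms(2) inj_on_subset unfolding indep_def by blast
  then show "card (f ` I) = card I" by (rule card_image)
  have "I \<subseteq> U" "finite I" using assms(2) by (auto simp: indep_def)
  show "indep V F (f ` I)" unfolding indep_def
  proof (intro conjI ballI impI)
    show "f ` I \<subseteq> V" using \<open>I \<subseteq> U\<close> embeddingD(2)[OF assms(1)] by blast
    fix a b assume "a \<in> f ` I" "b \<in> f ` I" "F a b"
    then obtain x y where xy: "x \<in> I" "y \<in> I" "a = f x" "b = f y" "F (f x) (f y)" by blast
    then have "E x y" using embeddingD(3)[OF assms(1), of x y] \<open>I \<subseteq> U\<close> by blast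
    then show "a = b" using xy assms(2) unfolding indep_def by blast
  qed (use \<open>finite I\<close> in simp)
qed

lemma embedding_inf_cls_ge:
  assumes "embedding f U E V F" "inf_cls_ge U E k" shows "inf_cls_ge V F k"
proof -
  obtain I where I: "card I = k" "indep U E I" "\<forall>x\<in>I. infinite (cls U E x)"
    using assms(2) unfolding inf_cls_ge_def by blast
  then have "\<forall>x\<in>I. infinite (cls V F (f x))"
    using embedding_infinite[OF assms(1)] unfolding indep_def by blast
  then show ?thesis unfolding inf_cls_ge_def
    using embedding_indep[OF assms(1) I(2)] I(1) by (intro exI[of _ "f ` I"]) blast
qed

lemma embedding_large_cls_ge:
  assumes "embedding f U E V F" "large_cls_ge U E k" shows "large_cls_ge V F k"
  unfolding large_cls_ge_def
proof
  fix n
  obtain I where I: "card I = k" "indep U E I" "\<forall>x\<in>I. at_least n (cls U E x)"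
    using assms(2) unfolding large_cls_ge_def by blast
  then have "\<forall>x\<in>I. at_least n (cls V F (f x))"
    using embedding_at_least[OF assms(1)] unfolding indep_def by blast
  then show "\<exists>I. card I = k \<and> indep V F I \<and> (\<forall>x\<in>I. at_least n (cls V F x))"
    using embedding_indep[OF assms(1) I(2)] I(1) by (intro exI[of _ "f ` I"]) blast
qed

lemma embedding_equivalence_structure:
  assumes f: "embedding f U E V F" and eq: "equivalence_structure V F"
  shows "equivalence_structure U E"
  unfolding equivalence_structure_iff
proof (intro conjI ballI impI)
  fix x assume x: "x \<in> U"
  then show "E x x" using embeddingD(2,3)[OF f] eqs_refl[OF eq] by blast
  fix y assume y: "y \<in> U" "E x y"
  then have xy: "F (f x) (f y)" using embeddingD(3)[OF f x] by blast
  then show "E y x" using eqs_sym[OF eq xy] embeddingD(2,3)[OF f] x y(1) by blast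
  fix z assume z: "z \<in> U" "E y z"
  then have "F (f y) (f z)" using embeddingD(3)[OF f y(1)] by blast
  then show "E x z" using eqs_trans[OF eq xy] embeddingD(2,3)[OF f] x y(1) z(1) by blast
qed

text \<open>For each covering element whose class is hit by \<open>f\<close>, one preimage of that
  class is kept. A large class is mapped into a large class, hence into a covered one.\<close>

lemma embedding_few_above:
  assumes f: "embedding f U E V F" and eq: "equivalence_structure V F" and "few_above V F m"
  shows "few_above U E m"
proof -
  obtain R where R: "finite R" "R \<subseteq> V" "\<And>x. x \<in> V \<Longrightarrow> at_least m (cls V F x) \<Longrightarrow> \<exists>y\<in>R. F x y"
    using assms(3) unfolding few_above_def by blast
  define w where "w y = (SOME x. x \<in> U \<and> F (f x) y)" for y
  let ?S = "w ` {y \<in> R. \<exists>x\<in>U. F (f x) y}"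
  have w: "w y \<in> U \<and> F (f (w y)) y" if "\<exists>x\<in>U. F (f x) y" for y
    unfolding w_def by (rule someI_ex) (use that in blast)
  have "\<exists>z\<in>?S. E x z" if x: "x \<in> U" "at_least m (cls U E x)" for x
  proof -
    obtain y where y: "y \<in> R" "F (f x) y"
      using R(3)[of "f x"] embedding_at_least[OF f x] embeddingD(2)[OF f x(1)] by blast
    then have wy: "w y \<in> U" "F (f (w y)) y" using w x by blast+
    have "F (f x) (f (w y))"
      using eqs_trans[OF eq y(2) eqs_sym[OF eq wy(2)]] y(1) R(2) wy(1) x(1) embeddingD(2)[OF f] by blast
    then have "E x (w y)" using embeddingD(3)[OF f x(1) wy(1)] by simp
    then show ?thesis using y x by blast
  qed
  moreover have "finite ?S" "?S \<subseteq> U" using R(1) w by auto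
  ultimately show ?thesis unfolding few_above_def by (intro exI[of _ ?S]) simp
qed

section \<open>Embeddings induced by maps of classes\<close>

lemma at_least_nth:
  assumes "at_least (Suc n) C" shows "\<exists>w\<in>C. card {z \<in> C. z < w} = n"
  using assms
proof (induction n)
  case 0
  then have "C \<noteq> {}" by (auto simp: at_least_def)
  then have "(LEAST w. w \<in> C) \<in> C" by (metis LeastI ex_in_conv)
  moreover have "{z \<in> C. z < (LEAST w. w \<in> C)} = {}" using not_less_Least by blast
  ultimately show ?case by (metis card.empty)
next
  case (Suc n)
  then obtain w where w: "w \<in> C" "card {z \<in> C. z < w} = n" using at_least_mono[of _ C "Suc n"] by auto
  have "\<exists>v. v \<in> C \<and> w < v"
  proof (rule ccontr)
    assume "\<not> ?thesis"
    then have C: "C = insert w {z \<in> C. z < w}" using w(1) by auto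
    moreover have "finite (insert w {z \<in> C. z < w})" by simp
    ultimately have fin: "finite C" by simp
    have "card C = card (insert w {z \<in> C. z < w})" using C by (rule arg_cong)
    then have "card C = Suc n" using w(2) by simp
    then show False using Suc.prems fin by (simp add: at_least_def)
  qed
  then have v: "(LEAST v. v \<in> C \<and> w < v) \<in> C \<and> w < (LEAST v. v \<in> C \<and> w < v)" by (rule LeastI_ex)
  moreover have "z \<le> w" if "z \<in> C" "z < (LEAST v. v \<in> C \<and> w < v)" for z
    using not_less_Least[OF that(2)] that(1) by simp
  ultimately have "{z \<in> C. z < (LEAST v. v \<in> C \<and> w < v)} = insert w {z \<in> C. z < w}"
    using w(1) by (auto simp: le_less)
  then have "card {z \<in> C. z < (LEAST v. v \<in> C \<and> w < v)} = Suc n" using w(2) by simp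
  then show ?case using v by blast
qed

text \<open>A map of classes becomes an embedding by sending the \<open>n\<close>th element of a class
  to the \<open>n\<close>th element of its image; unlike a choice of injections this is effective.\<close>
lemma embedding_of_class_map:
  assumes eq1: "equivalence_structure U E" and eq2: "equivalence_structure V F"
    and \<tau>: "\<And>x. x \<in> U \<Longrightarrow> \<tau> x \<in> V" "\<And>x y. x \<in> U \<Longrightarrow> y \<in> U \<Longrightarrow> F (\<tau> x) (\<tau> y) \<longleftrightarrow> E x y"
    and size: "\<And>x. x \<in> U \<Longrightarrow> at_least (Suc (pos U E x)) (cls V F (\<tau> x))"
    and f: "\<And>x. f x = (LEAST w. x \<notin> U \<or> w \<in> V \<and> F (\<tau> x) w \<and> pos V F w = pos U E x)"
  shows "\<exists>w. x \<notin> U \<or> w \<in> V \<and> F (\<tau> x) w \<and> pos V F w = pos U E x" and "embedding f U E V F"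
proof -
  \<comment> \<open>The disjunct \<open>x \<notin> U\<close> makes the search succeed for every
    \<open>x\<close>, so that \<open>f\<close> can be computed as a total function when the data are
    computable.\<close>
  have ex: "\<exists>w. x \<notin> U \<or> w \<in> V \<and> F (\<tau> x) w \<and> pos V F w = pos U E x" for x
  proof (cases "x \<in> U")
    case True
    obtain w where w: "w \<in> cls V F (\<tau> x)" "card {z \<in> cls V F (\<tau> x). z < w} = pos U E x"
      using at_least_nth[OF size[OF True]] by blast
    then have "cls V F w = cls V F (\<tau> x)"
      using cls_eq_iff[OF eq2, of w "\<tau> x"] \<tau>(1)[OF True] eqs_sym[OF eq2, of "\<tau> x" w] by (simp add: cls_def)
    then have "pos V F w = pos U E x" using w(2) by (simp add: pos_cls[OF eq2])
    then show ?thesis using w(1) by (auto simp: cls_def)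
  qed simp
  then show "\<exists>w. x \<notin> U \<or> w \<in> V \<and> F (\<tau> x) w \<and> pos V F w = pos U E x" .
  have fx: "f x \<in> V" "F (\<tau> x) (f x)" "pos V F (f x) = pos U E x" if "x \<in> U" for x
    using LeastI_ex[OF ex[of x]] that unfolding f[symmetric] by blast+
  have iff: "E x y \<longleftrightarrow> F (f x) (f y)" if "x \<in> U" "y \<in> U" for x y
  proof -
    have "E x y \<longleftrightarrow> cls V F (\<tau> x) = cls V F (\<tau> y)"
      using \<tau> that by (simp add: cls_eq_iff[OF eq2])
    also have "cls V F (\<tau> x) = cls V F (f x)" using cls_eq_iff[OF eq2] \<tau>(1) fx(1,2) that(1) by simp
    also have "cls V F (\<tau> y) = cls V F (f y)" using cls_eq_iff[OF eq2] \<tau>(1) fx(1,2) that(2) by simp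
    finally show ?thesis using fx(1) that by (simp add: cls_eq_iff[OF eq2])
  qed
  have "x = y" if "x \<in> U" "y \<in> U" "f x = f y" for x y
  proof (rule pos_inject[OF eq1 that(1,2)])
    show "E x y" using iff[OF that(1,2)] eqs_refl[OF eq2 fx(1)[OF that(1)]] that(3) by simp
    show "pos U E x = pos U E y" using fx(3) that by metis
  qed
  then show "embedding f U E V F" unfolding embedding_def using fx(1) iff
    by (intro conjI ballI inj_onI) blast+
qed

text \<open>An infinite class missed by the \<open>k\<close> representatives would extend them to
  \<open>k + 1\<close>, so they already meet every infinite class.\<close>

lemma inf_cls_maximal:
  assumes eq: "equivalence_structure U E" and "inf_cls_ge U E k" "\<not> inf_cls_ge U E (Suc k)"
  shows "\<exists>I. card I = k \<and> indep U E I \<and> (\<forall>x\<in>I. infinite (cls U E x)) \<and>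
    (\<forall>x\<in>U. infinite (cls U E x) \<longrightarrow> (\<exists>y\<in>I. E x y))"
proof -
  obtain I where I: "card I = k" "indep U E I" "\<And>x. x \<in> I \<Longrightarrow> infinite (cls U E x)"
    using assms(2) unfolding inf_cls_ge_def by blast
  have "\<exists>y\<in>I. E x y" if x: "x \<in> U" "infinite (cls U E x)" for x
  proof (rule ccontr)
    assume not: "\<not> (\<exists>y\<in>I. E x y)"
    then have not: "\<forall>y\<in>I. \<not> E x y" by blast
    have "inf_cls_ge U E (Suc k)" unfolding inf_cls_ge_def
      by (rule exI[of _ "insert x I"]) (use indep_insert[OF eq I(2) x(1) not] I(1,3) x(2) in simp)
    then show False using assms(3) by blast
  qed
  with I show ?thesis by blast
qed

lemma embedding_exists:
  assumes eq1: "equivalence_structure U E" and eq2: "equivalence_structure V F"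
    and k1: "inf_cls_ge U E k" "\<not> inf_cls_ge U E (Suc k)"
    and k2: "inf_cls_ge V F k" "\<not> inf_cls_ge V F (Suc k)"
    and large: "large_cls_ge V F (Suc k)"
  shows "\<exists>f. embedding f U E V F"
proof -
  obtain I where "card I = k" "indep U E I" "\<forall>x\<in>I. infinite (cls U E x)"
    "\<forall>x\<in>U. infinite (cls U E x) \<longrightarrow> (\<exists>y\<in>I. E x y)"
    using inf_cls_maximal[OF eq1 k1] by blast
  note I = this(1,2) bspec[OF this(3)] bspec[OF this(4), THEN mp]
  obtain J where "card J = k" "indep V F J" "\<forall>x\<in>J. infinite (cls V F x)"
    using inf_cls_maximal[OF eq2 k2] by blast
  note J = this(1,2) bspec[OF this(3)]
  obtain h where h: "bij_betw h I J"
    using finite_same_card_bij[of I J] I(1,2) J(1,2) unfolding indep_def by auto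
  \<comment> \<open>Of \<open>k + 1\<close> classes of size at least \<open>n\<close>, not all can
    be infinite.\<close>
  have big: "\<exists>x. x \<in> V \<and> finite (cls V F x) \<and> n \<le> card (cls V F x)" for n
  proof -
    obtain L where L: "card L = Suc k" "indep V F L" "\<forall>x\<in>L. at_least n (cls V F x)"
      using large unfolding large_cls_ge_def by blast
    then have "\<not> (\<forall>x\<in>L. infinite (cls V F x))" using k2(2) unfolding inf_cls_ge_def by blast
    then show ?thesis using L(2,3) unfolding at_least_def indep_def by blast
  qed
  \<comment> \<open>Strictly growing sizes make the classes of the \<open>g n\<close> pairwise
    different; size at least \<open>n\<close> at index \<open>n\<close> lets the index control the
    room.\<close>
  have "\<exists>g. \<forall>n. (g n \<in> V \<and> finite (cls V F (g n)) \<and> n \<le> card (cls V F (g n))) \<and>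
      card (cls V F (g n)) < card (cls V F (g (Suc n)))"
  proof (rule dependent_nat_choice)
    show "\<exists>x. x \<in> V \<and> finite (cls V F x) \<and> 0 \<le> card (cls V F x)" using big by blast
    fix x n
    obtain y where "y \<in> V" "finite (cls V F y)" "Suc (n + card (cls V F x)) \<le> card (cls V F y)"
      using big by blast
    then show "\<exists>y. (y \<in> V \<and> finite (cls V F y) \<and> Suc n \<le> card (cls V F y)) \<and> card (cls V F x) < card (cls V F y)"
      by (intro exI[of _ y]) auto
  qed
  then obtain g where g: "\<And>n. g n \<in> V" "\<And>n. finite (cls V F (g n))" "\<And>n. n \<le> card (cls V F (g n))"
    "\<And>n. card (cls V F (g n)) < card (cls V F (g (Suc n)))" by blast
  have "strict_mono (\<lambda>n. card (cls V F (g n)))" using g(4) by (simp add: strict_mono_Suc_iff)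
  then have g_inj: "i = j" if "cls V F (g i) = cls V F (g j)" for i j
    using that strict_mono_eq by metis
  \<comment> \<open>\<open>T\<close> takes the class as argument, so that \<open>\<tau>\<close> is
    constant on classes. In the index of a finite class the least element separates classes, and the
    size, which is at most the index, guarantees room.\<close>
  define T where "T C = (if infinite C then h (SOME y. y \<in> I \<and> y \<in> C)
    else g (prod_encode (LEAST z. z \<in> C, card C)))" for C
  define \<tau> where "\<tau> x = T (cls U E x)" for x
  have self: "x \<in> cls U E x" if "x \<in> U" for x using that eqs_refl[OF eq1] by (simp add: cls_def)
  have inf: "\<exists>y. y \<in> I \<and> y \<in> cls U E x \<and> \<tau> x = h y \<and> \<tau> x \<in> J" if x: "x \<in> U" "infinite (cls U E x)" for x
  proof -
    have "\<exists>y. y \<in> I \<and> y \<in> cls U E x" using I(2,4) x unfolding cls_def indep_def by blast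
    then have "(SOME y. y \<in> I \<and> y \<in> cls U E x) \<in> I \<and> (SOME y. y \<in> I \<and> y \<in> cls U E x) \<in> cls U E x"
      by (rule someI_ex)
    then show ?thesis using x h unfolding \<tau>_def T_def bij_betw_def by auto
  qed
  have fin: "\<exists>z. z \<in> cls U E x \<and> \<tau> x = g (prod_encode (z, card (cls U E x)))"
    if x: "x \<in> U" "finite (cls U E x)" for x
    unfolding \<tau>_def T_def using x(2) LeastI[of "\<lambda>z. z \<in> cls U E x", OF self[OF x(1)]] by auto
  have J_V: "J \<subseteq> V" using J(2) by (simp add: indep_def)
  have \<tau>_V: "\<tau> x \<in> V" if "x \<in> U" for x
    using inf[OF that] fin[OF that] g(1) J_V by (cases "finite (cls U E x)") auto
  have meet: "E x y" if "z \<in> cls U E x" "z \<in> cls U E y" "x \<in> U" "y \<in> U" for x y z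
    using that eqs_sym[OF eq1] eqs_trans[OF eq1] unfolding cls_def by blast
  have fin_iff: "finite (cls V F (\<tau> x)) \<longleftrightarrow> finite (cls U E x)" if "x \<in> U" for x
    using inf[OF that] fin[OF that] g(2) J(3) by metis
  have "F (\<tau> x) (\<tau> y) \<longleftrightarrow> E x y" if x: "x \<in> U" and y: "y \<in> U" for x y
  proof
    assume "E x y"
    then have "\<tau> x = \<tau> y" using cls_eq_iff[OF eq1 x y] by (simp add: \<tau>_def)
    then show "F (\<tau> x) (\<tau> y)" using eqs_refl[OF eq2] \<tau>_V y by simp
  next
    assume F: "F (\<tau> x) (\<tau> y)"
    then have cls: "cls V F (\<tau> x) = cls V F (\<tau> y)" using cls_eq_iff[OF eq2] \<tau>_V x y by simp
    show "E x y"
    proof (cases "finite (cls U E x)")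
      case True
      then have "finite (cls U E y)" using fin_iff x y cls by metis
      then obtain z z' where z: "z \<in> cls U E x" "\<tau> x = g (prod_encode (z, card (cls U E x)))"
        "z' \<in> cls U E y" "\<tau> y = g (prod_encode (z', card (cls U E y)))"
        using fin x y True by metis
      have "z = z'" using g_inj[OF cls[unfolded z(2,4)]] by simp
      then show ?thesis using meet z(1,3) x y by simp
    next
      case False
      then have "infinite (cls U E y)" using fin_iff x y cls by metis
      then obtain z z' where z: "z \<in> I" "z \<in> cls U E x" "\<tau> x = h z" "\<tau> x \<in> J"
        "z' \<in> I" "z' \<in> cls U E y" "\<tau> y = h z'" "\<tau> y \<in> J"
        using inf x y False by metis
      have "\<tau> x = \<tau> y" using J(2) F z(4,8) by (simp add: indep_def)
      then have "z = z'" using z h unfolding bij_betw_def inj_on_def by metis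
      then show ?thesis using meet z(2,6) x y by simp
    qed
  qed
  moreover have "at_least (Suc (pos U E x)) (cls V F (\<tau> x))" if x: "x \<in> U" for x
  proof (cases "finite (cls U E x)")
    case True
    obtain z where "\<tau> x = g (prod_encode (z, card (cls U E x)))" using fin[OF x True] by blast
    then have "card (cls U E x) \<le> card (cls V F (\<tau> x))"
      using g(3) le_prod_encode_2 order_trans by metis
    then show ?thesis using at_least_Suc_pos[OF eq1 x] True by (simp add: at_least_def)
  qed (use fin_iff[OF x] in \<open>simp add: at_least_def\<close>)
  ultimately show ?thesis using embedding_of_class_map(2)[OF eq1 eq2, of \<tau>, OF \<tau>_V _ _ refl] by blast
qed

section \<open>Computable embeddings for bounded class size\<close>

lemma decP_mem: "decidable U \<Longrightarrow> computable f \<Longrightarrow> decP (\<lambda>x. f x \<in> U)"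
  using decidable_iff_decP[of "\<lambda>x. x \<in> U"] decP_comp[of "\<lambda>x. x \<in> U" f] by simp

lemma decP_rel:
  assumes "computable_structure U E" "computable f" "computable g" shows "decP (\<lambda>x. E (f x) (g x))"
proof -
  have "computable2 (\<lambda>x y. of_bool (E x y))"
    using assms(1) unfolding computable_structure_def of_bool_def by blast
  from computable2_comp[OF this assms(2,3)] show ?thesis unfolding decP_def .
qed

lemma decP_finite_Ball: "finite R \<Longrightarrow> (\<And>y. y \<in> R \<Longrightarrow> decP (P y)) \<Longrightarrow> decP (\<lambda>x. \<forall>y\<in>R. P y x)"
  by (induction R rule: finite_induct) (simp_all add: comp_intros)

lemma computable_pos:
  assumes "computable_structure U E" "computable f" shows "computable (\<lambda>x. pos U E (f x))"
  unfolding pos_def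
  by (intro comp_intros assms computable_comp[OF assms(2)] decP_rel[OF assms(1)] decP_mem)
    (use assms in \<open>simp add: computable_structure_def\<close>)

text \<open>\<open>h\<close> may be any function: only its values on the finite set \<open>R\<close>
  occur, and these are built into the program.\<close>

lemma computable_cases:
  assumes "computable_structure U E" "computable g" "finite R"
  shows "\<exists>\<tau>. computable \<tau> \<and> (\<forall>x. (\<forall>y\<in>R. \<not> E x y) \<longrightarrow> \<tau> x = g x) \<and>
    (\<forall>x. (\<exists>y\<in>R. E x y) \<longrightarrow> (\<exists>y\<in>R. E x y \<and> \<tau> x = h y))"
  using assms(3)
proof (induction R rule: finite_induct)
  case empty
  then show ?case using assms(2) by (intro exI[of _ g]) simp
next
  case (insert a R)
  then obtain \<tau> where \<tau>: "computable \<tau>" "\<forall>x. (\<forall>y\<in>R. \<not> E x y) \<longrightarrow> \<tau> x = g x"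
    "\<forall>x. (\<exists>y\<in>R. E x y) \<longrightarrow> (\<exists>y\<in>R. E x y \<and> \<tau> x = h y)" by blast
  have "computable (\<lambda>x. if E x a then h a else \<tau> x)"
    by (intro comp_intros \<tau>(1) decP_rel[OF assms(1)])
  then show ?case using \<tau>(2,3) by (intro exI[of _ "\<lambda>x. if E x a then h a else \<tau> x"]) auto
qed

text \<open>Discarding the representatives of small classes turns the cover into an exact test:
  lying in a large class becomes a finite disjunction of instances of \<open>E\<close>.\<close>

lemma few_above_cover:
  assumes eq: "equivalence_structure U E" and "few_above U E M"
  shows "\<exists>R. finite R \<and> R \<subseteq> U \<and> (\<forall>y\<in>R. at_least M (cls U E y)) \<and>
    (\<forall>x\<in>U. at_least M (cls U E x) \<longleftrightarrow> (\<exists>y\<in>R. E x y))"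
proof -
  obtain R where R: "finite R" "R \<subseteq> U" "\<forall>x\<in>U. at_least M (cls U E x) \<longrightarrow> (\<exists>y\<in>R. E x y)"
    using assms(2) unfolding few_above_def by blast
  have eqc: "cls U E x = cls U E y" if "x \<in> U" "y \<in> R" "E x y" for x y
    using cls_eq_iff[OF eq, of x y] that R(2) by blast
  let ?R = "{y \<in> R. at_least M (cls U E y)}"
  have "at_least M (cls U E x) \<longleftrightarrow> (\<exists>y\<in>?R. E x y)" if x: "x \<in> U" for x
  proof
    assume "at_least M (cls U E x)"
    moreover from this obtain y where "y \<in> R" "E x y" using R(3) x by blast
    ultimately show "\<exists>y\<in>?R. E x y" using eqc[OF x, of y] by auto
  qed (use eqc[OF x] in auto)
  then show ?thesis using R(1,2) by (intro exI[of _ ?R]) auto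
qed

text \<open>A class of exactly \<open>m\<close> elements has a unique element of rank
  \<open>m - 1\<close>, its largest. Searching for such elements outside the finitely many larger
  classes lists representatives of distinct classes.\<close>

lemma computable_class_sequence:
  assumes cs: "computable_structure V F" and eq: "equivalence_structure V F"
    and few: "few_above V F (Suc m)" and many: "\<not> few_above V F m"
  shows "\<exists>e. computable e \<and> (\<forall>i. e i \<in> V \<and> \<not> at_least (Suc m) (cls V F (e i)) \<and> at_least m (cls V F (e i))) \<and>
    (\<forall>i j. F (e i) (e j) \<longrightarrow> i = j)"
proof -
  obtain R where R: "finite R" "R \<subseteq> V" "\<And>y. y \<in> R \<Longrightarrow> at_least (Suc m) (cls V F y)"
    "\<And>x. x \<in> V \<Longrightarrow> at_least (Suc m) (cls V F x) \<longleftrightarrow> (\<exists>y\<in>R. F x y)"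
    using few_above_cover[OF eq few] by metis
  \<comment> \<open>For \<open>m = 0\<close> the two bounds would coincide, as every class is
    nonempty.\<close>
  have m: "m > 0"
  proof (rule ccontr)
    assume "\<not> m > 0"
    then have "at_least (Suc m) (cls V F x)" if "x \<in> V" for x
      using at_least_mono[OF at_least_Suc_pos[OF eq that]] by simp
    then have "few_above V F m" unfolding few_above_def using R by (intro exI[of _ R]) simp
    then show False using many by simp
  qed
  define S where "S z \<longleftrightarrow> z \<in> V \<and> (\<forall>y\<in>R. \<not> F z y) \<and> Suc (pos V F z) = m" for z
  have inf: "\<exists>z>r. S z" for r
  proof (rule ccontr)
    assume "\<not> (\<exists>z>r. S z)"
    then have fin: "finite {z. S z}" by (intro finite_subset[of "{z. S z}" "{..r}"]) (auto simp: not_less)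
    \<comment> \<open>If there were only finitely many such elements, they would join
      \<open>R\<close> to cover all classes of size at least \<open>m\<close>.\<close>
    have "few_above V F m" unfolding few_above_def
    proof (intro exI[of _ "R \<union> {z. S z}"] conjI ballI impI)
      show "finite (R \<union> {z. S z})" "R \<union> {z. S z} \<subseteq> V" using R(1,2) fin by (auto simp: S_def)
      fix x assume x: "x \<in> V" "at_least m (cls V F x)"
      then obtain w where w: "w \<in> cls V F x" "card {z \<in> cls V F x. z < w} = m - 1"
        using at_least_nth[of "m - 1"] m by auto
      then have wx: "w \<in> V" "F x w" by (simp_all add: cls_def)
      then have "cls V F x = cls V F w" using cls_eq_iff[OF eq x(1) wx(1)] by simp
      then have "Suc (pos V F w) = m" using w(2) m by (simp add: pos_cls[OF eq])
      then have "S w \<or> (\<exists>y\<in>R. F w y)" using wx(1) by (auto simp: S_def)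
      then show "\<exists>y\<in>R \<union> {z. S z}. F x y"
        using wx eqs_trans[OF eq wx(2) _ x(1) wx(1)] R(2) by blast
    qed
    then show False using many by simp
  qed
  define e where "e i = rec_nat (LEAST z. S z) (\<lambda>_ r. LEAST z. r < z \<and> S z) i" for i
  have decS: "decP (\<lambda>x. S (f x))" if "computable f" for f
    unfolding S_def
    by (intro comp_intros decP_finite_Ball R(1) decP_rel[OF cs] computable_pos[OF cs] decP_mem that)
      (use cs in \<open>simp add: computable_structure_def\<close>)
  have "computable e" unfolding e_def
    by (intro comp_intros decS) (use inf in blast)
  have S: "S (e i)" for i
  proof (cases i)
    case 0
    have "\<exists>z. S z" using inf by blast
    then show ?thesis using 0 by (simp add: e_def LeastI_ex)
  next
    case (Suc j)
    show ?thesis using LeastI_ex[OF inf[of "e j"]] by (simp add: Suc e_def)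
  qed
  have "e i < e (Suc i)" for i
    using LeastI_ex[OF inf[of "e i"]] by (simp add: e_def)
  then have "strict_mono e" by (simp add: strict_mono_Suc_iff)
  have "i = j" if "F (e i) (e j)" for i j
  proof -
    have "Suc (pos V F (e i)) = Suc (pos V F (e j))" "e i \<in> V" "e j \<in> V"
      using S[of i] S[of j] by (simp_all add: S_def)
    then have "e i = e j" using pos_inject[OF eq _ _ that] by simp
    then show ?thesis using \<open>strict_mono e\<close> by (simp add: strict_mono_eq)
  qed
  moreover have "e i \<in> V \<and> \<not> at_least (Suc m) (cls V F (e i)) \<and> at_least m (cls V F (e i))" for i
    using S[of i] R(4)[of "e i"] at_least_Suc_pos[OF eq, of "e i"] by (auto simp: S_def)
  ultimately show ?thesis using \<open>computable e\<close> by blast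
qed

lemma computable_embedding:
  assumes cs1: "computable_structure U E" and cs2: "computable_structure V F"
    and eq1: "equivalence_structure U E" and eq2: "equivalence_structure V F"
    and h: "embedding h U E V F" and h': "embedding h' V F U E"
    and "few_above V F N"
  shows "\<exists>f. computable f \<and> embedding f U E V F"
proof -
  \<comment> \<open>One threshold serves both structures: the cover pulls back along
    \<open>h\<close>, and for \<open>M > 0\<close> minimality in the target supplies infinitely many
    classes of size exactly \<open>M - 1\<close>.\<close>
  define M where "M = (LEAST M. few_above V F M)"
  have few2: "few_above V F M" unfolding M_def using assms(7) by (rule LeastI)
  then have few1: "few_above U E M" by (rule embedding_few_above[OF h eq2])
  have "\<exists>e. computable e \<and> (0 < M \<longrightarrow> (\<forall>i. e i \<in> V \<and> \<not> at_least M (cls V F (e i)) \<and>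
    at_least (M - 1) (cls V F (e i))) \<and> (\<forall>i j. F (e i) (e j) \<longrightarrow> i = j))"
  proof (cases M)
    case 0
    \<comment> \<open>Here every class counts as large and is treated by the table, so the values of
      \<open>e\<close> do not matter.\<close>
    then show ?thesis using computable_basic(1) by (intro exI[of _ "\<lambda>x. x"]) simp
  next
    case (Suc m)
    then have "\<not> few_above V F m" unfolding M_def using not_less_Least[of m "few_above V F"] by simp
    from computable_class_sequence[OF cs2 eq2 _ this] few2 Suc show ?thesis by simp
  qed
  then obtain e where e: "computable e" "\<And>i. 0 < M \<Longrightarrow> e i \<in> V"
    "\<And>i. 0 < M \<Longrightarrow> \<not> at_least M (cls V F (e i))"
    "\<And>i. 0 < M \<Longrightarrow> at_least (M - 1) (cls V F (e i))"
    "\<And>i j. 0 < M \<Longrightarrow> F (e i) (e j) \<Longrightarrow> i = j" by metis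
  obtain R where R: "finite R" "R \<subseteq> U" "\<And>y. y \<in> R \<Longrightarrow> at_least M (cls U E y)"
    "\<And>x. x \<in> U \<Longrightarrow> at_least M (cls U E x) \<longleftrightarrow> (\<exists>y\<in>R. E x y)"
    using few_above_cover[OF eq1 few1] by metis
  \<comment> \<open>The least element of a class serves as its index, so \<open>e (c x)\<close>
    depends on the class alone.\<close>
  define c where "c x = (LEAST y. x \<notin> U \<or> y \<in> U \<and> E x y)" for x
  have decU: "decidable U" "decidable V" using cs1 cs2 by (simp_all add: computable_structure_def)
  have c_ex: "\<exists>y. x \<notin> U \<or> y \<in> U \<and> E x y" for x using eqs_refl[OF eq1] by blast
  have "computable c" unfolding c_def[abs_def]
    by (intro comp_intros decP_mem decU decP_rel[OF cs1] c_ex)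
  have c: "c x \<in> U" "E x (c x)" if "x \<in> U" for x
    using LeastI_ex[OF c_ex[of x]] that unfolding c_def by blast+
  have c_eq: "c x = c y \<longleftrightarrow> E x y" if xy: "x \<in> U" "y \<in> U" for x y
  proof
    assume "c x = c y"
    then show "E x y" using c[OF xy(1)] c[OF xy(2)] eqs_sym[OF eq1] eqs_trans[OF eq1] xy by metis
  next
    assume "E x y"
    then have "cls U E x = cls U E y" using cls_eq_iff[OF eq1 xy] by simp
    then have "x \<notin> U \<or> z \<in> U \<and> E x z \<longleftrightarrow> y \<notin> U \<or> z \<in> U \<and> E y z" for z
      using xy unfolding cls_def by blast
    then show "c x = c y" unfolding c_def by presburger
  qed
  have "computable (\<lambda>x. e (c x))" using e(1) \<open>computable c\<close> by (rule computable_comp)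
  from computable_cases[OF cs1 this R(1), of h] obtain \<tau> where \<tau>: "computable \<tau>"
    "\<And>x. \<forall>y\<in>R. \<not> E x y \<Longrightarrow> \<tau> x = e (c x)" "\<And>x. \<exists>y\<in>R. E x y \<Longrightarrow> \<exists>y\<in>R. E x y \<and> \<tau> x = h y"
    by blast
  define f where "f x = (LEAST w. x \<notin> U \<or> w \<in> V \<and> F (\<tau> x) w \<and> pos V F w = pos U E x)" for x
  have large: "\<exists>y\<in>R. E x y \<and> cls U E x = cls U E y \<and> \<tau> x = h y \<and> y \<in> U"
    if x: "x \<in> U" "at_least M (cls U E x)" for x
  proof -
    obtain y where y: "y \<in> R" "E x y" "\<tau> x = h y" using \<tau>(3) R(4)[OF x(1)] x(2) by blast
    moreover have "y \<in> U" using y(1) R(2) by blast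
    ultimately show ?thesis using cls_eq_iff[OF eq1 x(1)] by blast
  qed
  have small: "\<tau> x = e (c x) \<and> 0 < M" if x: "x \<in> U" "\<not> at_least M (cls U E x)" for x
  proof
    show "\<tau> x = e (c x)" using \<tau>(2) R(4)[OF x(1)] x(2) by blast
    show "0 < M" using x(2) by (cases M) (auto simp: at_least_def)
  qed
  have \<tau>_V: "\<tau> x \<in> V" if x: "x \<in> U" for x
  proof (cases "at_least M (cls U E x)")
    case True
    then show ?thesis using large[OF x] embeddingD(2)[OF h] by auto
  next
    case False
    then show ?thesis using small[OF x] e(2) by simp
  qed
  have \<tau>_large: "at_least M (cls V F (\<tau> x)) \<longleftrightarrow> at_least M (cls U E x)" if x: "x \<in> U" for x
  proof (cases "at_least M (cls U E x)")
    case True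
    then obtain y where "y \<in> R" "\<tau> x = h y" "y \<in> U" using large[OF x] by blast
    then show ?thesis using embedding_at_least[OF h] R(3) True by simp
  next
    case False
    then show ?thesis using small[OF x] e(3) by simp
  qed
  have \<tau>_iff: "F (\<tau> x) (\<tau> y) \<longleftrightarrow> E x y" if x: "x \<in> U" and y: "y \<in> U" for x y
  proof (cases "at_least M (cls U E x) \<longleftrightarrow> at_least M (cls U E y)")
    case False
    \<comment> \<open>Images of large classes are large and images of small ones small, so the table
      and the sequence cannot collide.\<close>
    then have "cls V F (\<tau> x) \<noteq> cls V F (\<tau> y)" "cls U E x \<noteq> cls U E y"
      using \<tau>_large[OF x] \<tau>_large[OF y] by metis+
    then show ?thesis using cls_eq_iff[OF eq1 x y] cls_eq_iff[OF eq2 \<tau>_V[OF x] \<tau>_V[OF y]] by simp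
  next
    case same: True
    show ?thesis
    proof (cases "at_least M (cls U E x)")
      case True
      obtain a where a: "cls U E x = cls U E a" "\<tau> x = h a" "a \<in> U" using large[OF x True] by blast
      obtain b where b: "cls U E y = cls U E b" "\<tau> y = h b" "b \<in> U" using large[OF y] True same by blast
      have "F (\<tau> x) (\<tau> y) \<longleftrightarrow> E a b" using embeddingD(3)[OF h a(3) b(3)] a(2) b(2) by simp
      also have "\<dots> \<longleftrightarrow> E x y"
        using cls_eq_iff[OF eq1 a(3) b(3)] cls_eq_iff[OF eq1 x y] a(1) b(1) by simp
      finally show ?thesis .
    next
      case False
      then have xy: "\<tau> x = e (c x)" "\<tau> y = e (c y)" "0 < M" using small[OF x] small[OF y] same by blast+
      have "F (e (c x)) (e (c y)) \<longleftrightarrow> c x = c y"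
        using e(5)[OF xy(3)] eqs_refl[OF eq2 e(2)[OF xy(3)]] by metis
      then show ?thesis using c_eq[OF x y] xy(1,2) by simp
    qed
  qed
  have size: "at_least (Suc (pos U E x)) (cls V F (\<tau> x))" if x: "x \<in> U" for x
  proof (cases "at_least M (cls U E x)")
    case True
    then obtain y where "cls U E x = cls U E y" "\<tau> x = h y" "y \<in> U" using large[OF x] by blast
    then show ?thesis using embedding_at_least[OF h] at_least_Suc_pos[OF eq1 x] by simp
  next
    case False
    have "at_least (M - 1) (cls V F (\<tau> x))" using small[OF x False] e(4) by simp
    \<comment> \<open>A class without \<open>M\<close> elements is finite of size at most
      \<open>M - 1\<close>, so the rank of \<open>x\<close> exists in the target class.\<close>
    moreover have "Suc (pos U E x) \<le> M - 1"
      using False at_least_Suc_pos[OF eq1 x] by (auto simp: at_least_def)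
    ultimately show ?thesis by (rule at_least_mono)
  qed
  note emb = embedding_of_class_map[OF eq1 eq2, of \<tau>, OF \<tau>_V \<tau>_iff size f_def]
  have "computable f" unfolding f_def[abs_def]
    by (intro comp_intros decP_mem decU decP_rel[OF cs2] computable_comp[OF \<tau>(1)]
        computable_pos[OF cs1] computable_pos[OF cs2] emb(1))
  then show ?thesis using emb(2) by blast
qed

text \<open>All copies inherit the bound along their embeddings into the given structure, so any two
  of them embed into each other computably. The oracle \<open>chi {}\<close> coincides with
  \<open>no_oracle\<close>, hence the empty set would compute the halting set.\<close>

lemma bec_jump_not_few_above:
  assumes eq: "equivalence_structure U E" and jump: "bec_degree_is_jump U E"
  shows "\<not> few_above U E N"
proof
  assume few: "few_above U E N"
  have orc: "chi {} = no_oracle" by (simp add: chi_def no_oracle_def fun_eq_iff)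
  have "\<exists>f. computable_in (chi {}) f \<and> embedding f U1 E1 U2 E2"
    if cs: "computable_structure U1 E1" "computable_structure U2 E2"
      and bi: "bi_embeddable U1 E1 U E" "bi_embeddable U2 E2 U E" for U1 E1 U2 E2
  proof -
    obtain a a' b b' where emb: "embedding a U1 E1 U E" "embedding a' U E U1 E1"
      "embedding b U2 E2 U E" "embedding b' U E U2 E2"
      using bi unfolding bi_embeddable_def by blast
    have comp: "embedding (\<lambda>x. g (f x)) A R C T" if "embedding f A R B S" "embedding g B S C T" for f g A R B S C T
      using that unfolding embedding_def by (auto simp: inj_on_def image_subset_iff)
    show ?thesis
      using computable_embedding[OF cs embedding_equivalence_structure[OF emb(1) eq]
          embedding_equivalence_structure[OF emb(3) eq] comp[OF emb(1,4)] comp[OF emb(3,2)]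
          embedding_few_above[OF emb(3) eq few]]
      unfolding orc computable_def .
  qed
  then have "bec_computes U E {}" unfolding bec_computes_def by blast
  then have "turing_le halting_set {}" using jump unfolding bec_degree_is_jump_def by blast
  then have "decidable halting_set" by (simp add: turing_le_def decidable_def computable_def orc)
  then show False using halting_set_undecidable by blast
qed

lemma inf_cls_ge_iff:
  assumes eq: "equivalence_structure U E" and fin: "finite (infinite_classes U E)"
  shows "inf_cls_ge U E k \<longleftrightarrow> k \<le> card (infinite_classes U E)"
proof -
  have "{(x, y). x \<in> U \<and> y \<in> U \<and> E x y} `` {x} = cls U E x" if "x \<in> U" for x
    using that by (auto simp: cls_def)
  then have ic: "infinite_classes U E = {C. \<exists>x\<in>U. C = cls U E x \<and> infinite C}"
    unfolding infinite_classes_def quotient_def by auto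
  show ?thesis
  proof
    assume "inf_cls_ge U E k"
    then obtain I where I: "card I = k" "indep U E I" "\<forall>x\<in>I. infinite (cls U E x)"
      unfolding inf_cls_ge_def by blast
    have "inj_on (cls U E) I"
    proof (rule inj_onI)
      fix x y assume "x \<in> I" "y \<in> I" "cls U E x = cls U E y"
      then show "x = y" using I(2) cls_eq_iff[OF eq, of x y] unfolding indep_def by blast
    qed
    moreover have "cls U E ` I \<subseteq> infinite_classes U E" using I(2,3) unfolding ic indep_def by blast
    ultimately show "k \<le> card (infinite_classes U E)" using I(1) fin card_inj_on_le by blast
  next
    assume "k \<le> card (infinite_classes U E)"
    then obtain D where D: "D \<subseteq> infinite_classes U E" "card D = k" "finite D"
      using obtain_subset_with_card_n by metis
    then have "\<forall>C\<in>D. \<exists>x. x \<in> U \<and> C = cls U E x \<and> infinite C" unfolding ic by blast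
    then obtain r where r: "\<forall>C\<in>D. r C \<in> U \<and> C = cls U E (r C) \<and> infinite C" by metis
    have "inj_on r D" using r by (intro inj_onI) metis
    then have "card (r ` D) = k" using D(2) by (simp add: card_image)
    moreover have "x = y" if "x \<in> r ` D" "y \<in> r ` D" "E x y" for x y
    proof -
      obtain A B where AB: "A \<in> D" "B \<in> D" "x = r A" "y = r B" using \<open>x \<in> r ` D\<close> \<open>y \<in> r ` D\<close> by blast
      then have "cls U E x = cls U E y" using cls_eq_iff[OF eq, of x y] r that(3) by blast
      then have "A = B" using r AB by metis
      then show ?thesis using AB by simp
    qed
    then have "indep U E (r ` D)" unfolding indep_def using r D(3) by blast
    moreover have "\<forall>x\<in>r ` D. infinite (cls U E x)" using r by auto
    ultimately show "inf_cls_ge U E k" unfolding inf_cls_ge_def by blast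
  qed
qed

section \<open>Complexity of the index set\<close>

abbreviation Cs :: "nat \<Rightarrow> nat \<Rightarrow> nat set" where "Cs e \<equiv> cls UNIV (Crel e)"

text \<open>Negated instances of the relation are expressed by the value 0. Everything below the
  universal quantifiers is then Sigma_1, and the whole condition Pi_2.\<close>

definition structure_code :: "nat \<Rightarrow> bool" where
  "structure_code e \<longleftrightarrow> (\<forall>x y z. (Ev e x y 0 \<or> Ev e x y 1) \<and> Ev e x x 1 \<and>
     (Ev e x y 0 \<or> Ev e y x 1) \<and> (Ev e x y 0 \<or> Ev e y z 0 \<or> Ev e x z 1))"

lemma C_is_structure_imp_code: assumes "C_is_structure e" shows "e \<in> range code"
proof (rule ccontr)
  assume "e \<notin> range code"
  then have "decode e = Zf" by (auto simp: decode_def)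
  moreover have "Crel e 0 0"
    using assms unfolding C_is_structure_def equivalence_structure_iff by blast
  ultimately have "ev Zf [0, 0] 1" by (simp add: Crel_def)
  then show False by cases simp
qed

lemma Ev_deterministic: "Ev e x y v \<Longrightarrow> Ev e x y w \<Longrightarrow> v = w"
  unfolding Ev_def using eval_deterministic by blast

lemma C_is_structure_Crel:
  assumes "C_is_structure e"
  shows "Crel e x y \<longleftrightarrow> Ev e x y 1" "\<not> Crel e x y \<longleftrightarrow> Ev e x y 0"
proof -
  have e: "e \<in> range code" using assms by (rule C_is_structure_imp_code)
  show 1: "Crel e x y \<longleftrightarrow> Ev e x y 1" using e by (simp add: Crel_def Ev_def)
  obtain v where "v \<le> 1" "Ev e x y v"
    using assms e unfolding C_is_structure_def Ev_def by blast
  then have "Ev e x y 0 \<or> Ev e x y 1" by (cases v) auto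
  then show "\<not> Crel e x y \<longleftrightarrow> Ev e x y 0" unfolding 1 using Ev_deterministic[of e x y 0 1] by auto
qed

lemma C_is_structure_iff: "C_is_structure e \<longleftrightarrow> structure_code e"
proof
  assume st: "C_is_structure e"
  then have eq: "equivalence_structure UNIV (Crel e)" by (simp add: C_is_structure_def)
  show "structure_code e" unfolding structure_code_def C_is_structure_Crel[OF st, symmetric]
    using eqs_refl[OF eq] eqs_sym[OF eq] eqs_trans[OF eq] by blast
next
  assume sc: "structure_code e"
  then have Ev: "Ev e x y 0 \<or> Ev e x y 1" "Ev e x x 1" "Ev e x y 0 \<or> Ev e y x 1"
    "Ev e x y 0 \<or> Ev e y z 0 \<or> Ev e x z 1" for x y z
    unfolding structure_code_def by blast+
  have e: "e \<in> range code" using Ev(2)[of 0] by (simp add: Ev_def)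
  have C: "Crel e x y \<longleftrightarrow> Ev e x y 1" for x y using e by (simp add: Crel_def Ev_def)
  have not0: "\<not> Ev e x y 0" if "Ev e x y 1" for x y using Ev_deterministic[OF that, of 0] by auto
  have "\<exists>v. v \<le> 1 \<and> eval no_oracle (decode e) [x, y] v" for x y
    using Ev(1)[of x y] unfolding Ev_def by (metis le_numeral_extra(3,4) zero_le)
  moreover have "equivalence_structure UNIV (Crel e)"
    unfolding equivalence_structure_iff C using Ev not0 by blast
  ultimately show "C_is_structure e" unfolding C_is_structure_def by blast
qed

lemma infinite_iff_at_least: "infinite C \<longleftrightarrow> (\<forall>n. at_least n C)"
  unfolding at_least_def using not_less_eq_eq by blast

text \<open>One coded list replaces \<open>n\<close> existential quantifiers, where \<open>n\<close>
  may depend on the input.\<close>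

lemma at_least_iff_list: "at_least n C \<longleftrightarrow>
  (\<exists>l. \<forall>i<n. lnth l i \<in> C \<and> (\<forall>j<i. lnth l j \<noteq> lnth l i))"
proof
  assume "at_least n C"
  then obtain D where D: "D \<subseteq> C" "card D = n" "finite D"
    using infinite_arbitrarily_large[of C n] obtain_subset_with_card_n[of n C]
    unfolding at_least_def by metis
  then obtain w where w: "bij_betw w {0..<n} D" using ex_bij_betw_nat_finite by blast
  then have inj: "inj_on w {0..<n}" and "w ` {0..<n} = D" by (simp_all add: bij_betw_def)
  then have "w i \<in> C" if "i < n" for i using that D(1) by auto
  moreover have "w j \<noteq> w i" if "i < n" "j < i" for i j using inj_onD[OF inj, of j i] that by auto
  ultimately have "w i \<in> C \<and> (\<forall>j<i. w j \<noteq> w i)" if "i < n" for i using that by blast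
  then show "\<exists>l. \<forall>i<n. lnth l i \<in> C \<and> (\<forall>j<i. lnth l j \<noteq> lnth l i)"
    by (intro exI[of _ "list_encode (map w [0..<n])"]) simp
next
  assume "\<exists>l. \<forall>i<n. lnth l i \<in> C \<and> (\<forall>j<i. lnth l j \<noteq> lnth l i)"
  then obtain l where l: "\<And>i. i < n \<Longrightarrow> lnth l i \<in> C" "\<And>i j. i < n \<Longrightarrow> j < i \<Longrightarrow> lnth l j \<noteq> lnth l i"
    by blast
  have "inj_on (lnth l) {..<n}"
    by (rule linorder_inj_onI) (use l(2) in auto)
  moreover have "at_least n {..<n}" by (simp add: at_least_def)
  ultimately show "at_least n C" using l(1) by (elim at_least_inj[rotated]) auto
qed

lemma indep_iff_list:
  assumes eq: "equivalence_structure UNIV E"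
  shows "(\<exists>I. card I = k \<and> indep UNIV E I \<and> (\<forall>x\<in>I. Q x)) \<longleftrightarrow>
    (\<exists>l. \<forall>i<k. Q (lnth l i) \<and> (\<forall>j<i. \<not> E (lnth l j) (lnth l i)))"
proof
  assume "\<exists>I. card I = k \<and> indep UNIV E I \<and> (\<forall>x\<in>I. Q x)"
  then obtain I where I: "card I = k" "finite I" "\<And>x y. x \<in> I \<Longrightarrow> y \<in> I \<Longrightarrow> E x y \<Longrightarrow> x = y"
    "\<And>x. x \<in> I \<Longrightarrow> Q x"
    unfolding indep_def by blast
  then obtain w where w: "bij_betw w {0..<k} I" using ex_bij_betw_nat_finite by blast
  have wI: "w i \<in> I" if "i < k" for i using w that unfolding bij_betw_def by auto
  have "\<not> E (w j) (w i)" if "i < k" "j < i" for i j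
  proof
    assume "E (w j) (w i)"
    then have "w j = w i" using I(3) wI that by simp
    then show False using inj_onD[OF bij_betw_imp_inj_on[OF w], of j i] that by simp
  qed
  then show "\<exists>l. \<forall>i<k. Q (lnth l i) \<and> (\<forall>j<i. \<not> E (lnth l j) (lnth l i))"
    using I(4) wI by (intro exI[of _ "list_encode (map w [0..<k])"]) simp
next
  assume "\<exists>l. \<forall>i<k. Q (lnth l i) \<and> (\<forall>j<i. \<not> E (lnth l j) (lnth l i))"
  then obtain l where l: "\<And>i. i < k \<Longrightarrow> Q (lnth l i)"
    "\<And>i j. i < k \<Longrightarrow> j < i \<Longrightarrow> \<not> E (lnth l j) (lnth l i)" by blast
  have ij: "i = j" if "i < k" "j < k" "E (lnth l i) (lnth l j)" for i j
    using l(2)[of i j] l(2)[of j i] that eqs_sym[OF eq that(3)] by (cases i j rule: linorder_cases) auto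
  then have "inj_on (lnth l) {..<k}" using eqs_refl[OF eq] by (intro inj_onI) auto
  then have "card (lnth l ` {..<k}) = k" by (simp add: card_image)
  moreover have "indep UNIV E (lnth l ` {..<k})"
    unfolding indep_def using ij by auto
  ultimately show "\<exists>I. card I = k \<and> indep UNIV E I \<and> (\<forall>x\<in>I. Q x)"
    using l(1) by (intro exI[of _ "lnth l ` {..<k}"]) auto
qed

text \<open>One Sigma_1 matrix serves two notions on structures: preceded by \<forall>n \<exists>l
  it expresses \<open>large_cls_ge\<close>, preceded by \<exists>l \<forall>n it expresses
  \<open>inf_cls_ge\<close>. Here \<open>l\<close> lists representatives and \<open>m\<close> lists
  elements of one class.\<close>

definition class_witness :: "nat \<Rightarrow> nat \<Rightarrow> nat \<Rightarrow> nat \<Rightarrow> bool" where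
  "class_witness k e l n \<longleftrightarrow> (\<forall>i<k.
     (\<exists>m. \<forall>a<n. Ev e (lnth l i) (lnth m a) 1 \<and> (\<forall>b<a. lnth m b \<noteq> lnth m a)) \<and>
     (\<forall>j<i. Ev e (lnth l j) (lnth l i) 0))"

lemma class_witness_iff:
  assumes "C_is_structure e"
  shows "class_witness k e l n \<longleftrightarrow>
    (\<forall>i<k. at_least n (Cs e (lnth l i)) \<and> (\<forall>j<i. \<not> Crel e (lnth l j) (lnth l i)))"
  unfolding class_witness_def at_least_iff_list C_is_structure_Crel[OF assms, symmetric] cls_def by simp

lemma large_cls_ge_iff:
  assumes "C_is_structure e"
  shows "large_cls_ge UNIV (Crel e) k \<longleftrightarrow> (\<forall>n. \<exists>l. class_witness k e l n)"
proof -
  have eq: "equivalence_structure UNIV (Crel e)" using assms by (simp add: C_is_structure_def)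
  show ?thesis unfolding large_cls_ge_def indep_iff_list[OF eq] class_witness_iff[OF assms] ..
qed

lemma inf_cls_ge_iff_witness:
  assumes "C_is_structure e"
  shows "inf_cls_ge UNIV (Crel e) k \<longleftrightarrow> (\<exists>l. \<forall>n. class_witness k e l n)"
proof -
  have eq: "equivalence_structure UNIV (Crel e)" using assms by (simp add: C_is_structure_def)
  show ?thesis
    unfolding inf_cls_ge_def indep_iff_list[OF eq] class_witness_iff[OF assms] infinite_iff_at_least
    by blast
qed

lemma Sg_1_Ex: "Sg 1 (\<lambda>p. P (pfst p) (psnd p)) \<Longrightarrow> Sg 1 (\<lambda>x. \<exists>y. P x y)"
  unfolding One_nat_def by (rule Sg_Ex)

lemma Sg_1_neq: "computable f \<Longrightarrow> computable g \<Longrightarrow> Sg 1 (\<lambda>x. f x \<noteq> g x)"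
  by (intro Sg_of_decP comp_intros)

lemma Sg_1_class_witness:
  assumes "computable e" "computable l" "computable n"
  shows "Sg 1 (\<lambda>p. class_witness k (e p) (l p) (n p))"
proof -
  have "Sg 1 (\<lambda>p. class_witness k (pfst p) (pfst (psnd p)) (psnd (psnd p)))"
    unfolding class_witness_def
    by (intro Sg_1_ball Sg_conj Sg_1_Ex Sg_1_Ev Sg_1_neq comp_intros)
  moreover have "computable (\<lambda>p. prod_encode (e p, prod_encode (l p, n p)))"
    using assms by (intro comp_intros)
  ultimately have "Sg 1 (\<lambda>x. class_witness k (pfst (prod_encode (e x, prod_encode (l x, n x))))
    (pfst (psnd (prod_encode (e x, prod_encode (l x, n x)))))
    (psnd (psnd (prod_encode (e x, prod_encode (l x, n x))))))" by (rule Sg_comp)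
  then show ?thesis by simp
qed

lemma Pg_structure_code: "Pg (Suc 1) structure_code"
  unfolding structure_code_def[abs_def]
  by (intro Pg_All Pg_All_Sg Sg_conj Sg_disj Sg_1_Ev comp_intros)

lemma Pg_large_witness: "Pg (Suc 1) (\<lambda>e. \<forall>n. \<exists>l. class_witness k e l n)"
  by (intro Pg_All_Sg Sg_1_Ex Sg_1_class_witness comp_intros)

lemma Sg_inf_witness: "Sg (Suc (Suc 1)) (\<lambda>e. \<exists>l. \<forall>n. class_witness k e l n)"
  by (intro Sg_Ex_Pg Pg_All_Sg Sg_1_class_witness comp_intros)

text \<open>The conditions on the right are invariant under bi-embeddability and hold for the given
  structure. If they hold for \<open>Crel e\<close> too, \<open>embedding_exists\<close> applies in
  both directions.\<close>

lemma bi_emb_index_set_iff: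
  assumes eq: "equivalence_structure U E" and few: "\<And>m. \<not> few_above U E m"
    and k: "inf_cls_ge U E k" "\<not> inf_cls_ge U E (Suc k)"
  shows "e \<in> bi_emb_index_set U E \<longleftrightarrow> C_is_structure e \<and> large_cls_ge UNIV (Crel e) (Suc k) \<and>
    inf_cls_ge UNIV (Crel e) k \<and> \<not> inf_cls_ge UNIV (Crel e) (Suc k)"
proof -
  have large: "large_cls_ge U E (Suc k)" using large_cls_ge_of_not_few_above[OF eq few] .
  have "bi_embeddable UNIV (Crel e) U E \<longleftrightarrow> large_cls_ge UNIV (Crel e) (Suc k) \<and>
    inf_cls_ge UNIV (Crel e) k \<and> \<not> inf_cls_ge UNIV (Crel e) (Suc k)" (is "_ \<longleftrightarrow> ?R")
    if "C_is_structure e"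
  proof
    assume "bi_embeddable UNIV (Crel e) U E"
    then obtain f g where "embedding f UNIV (Crel e) U E" "embedding g U E UNIV (Crel e)"
      unfolding bi_embeddable_def by blast
    then show ?R
      using embedding_large_cls_ge large embedding_inf_cls_ge k by blast
  next
    assume R: ?R
    have "equivalence_structure UNIV (Crel e)" using that by (simp add: C_is_structure_def)
    then show "bi_embeddable UNIV (Crel e) U E"
      unfolding bi_embeddable_def using embedding_exists[of _ _ _ _ k] eq k R large by blast
  qed
  then show ?thesis unfolding bi_emb_index_set_def by blast
qed

lemma bi_emb_index_set_upper:
  assumes "equivalence_structure U E" "\<And>m. \<not> few_above U E m"
    "inf_cls_ge U E k" "\<not> inf_cls_ge U E (Suc k)"
  shows "k = 0 \<Longrightarrow> bi_emb_index_set U E \<in> Pi0 3" "bi_emb_index_set U E \<in> D0 3"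
proof -
  let ?S = "\<lambda>k e. \<exists>l. \<forall>n. class_witness k e l n"
  let ?P = "\<lambda>e. structure_code e \<and> (\<forall>n. \<exists>l. class_witness (Suc k) e l n) \<and> \<not> ?S (Suc k) e"
  have I: "bi_emb_index_set U E = {e. ?S k e} \<inter> {e. ?P e}"
  proof (rule set_eqI)
    fix e
    show "e \<in> bi_emb_index_set U E \<longleftrightarrow> e \<in> {e. ?S k e} \<inter> {e. ?P e}"
      unfolding bi_emb_index_set_iff[OF assms]
      using large_cls_ge_iff[of e] inf_cls_ge_iff_witness[of e] C_is_structure_iff[of e]
      by (cases "C_is_structure e") (simp_all add: conj_ac)
  qed
  have "{e. ?S k e} \<in> Sigma0 3"
    using Sg_inf_witness[of k] by (simp add: Sg_def numeral_3_eq_3)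
  have "Pg 3 ?P" unfolding numeral_3_eq_3
    using Pg_Suc_of_Pg[OF Pg_structure_code] Pg_Suc_of_Pg[OF Pg_large_witness[of "Suc k"]]
      Sg_inf_witness[of "Suc k"]
    by (intro Pg_conj Pg_Not) simp_all
  then have P: "{e. ?P e} \<in> Pi0 3" by (simp only: Pg_iff)
  show "bi_emb_index_set U E \<in> D0 3"
    unfolding D0_def I using P \<open>{e. ?S k e} \<in> Sigma0 3\<close> by blast
  show "bi_emb_index_set U E \<in> Pi0 3" if "k = 0"
  proof -
    \<comment> \<open>With no representative to name, the empty conjunction holds for every
      \<open>e\<close>, whether or not it is an index of a structure.\<close>
    have "{e. ?S k e} = UNIV" using that by (simp add: class_witness_def)
    then show ?thesis unfolding I using P by simp
  qed
qed

section \<open>Hardness of the index set\<close>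

lemma decP3_comp:
  assumes "decP (\<lambda>p. F (pfst p) (pfst (psnd p)) (psnd (psnd p)))"
    "computable f" "computable g" "computable h"
  shows "decP (\<lambda>x. F (f x) (g x) (h x))"
proof -
  have "computable (\<lambda>x. prod_encode (f x, prod_encode (g x, h x)))" using assms(2-) by (intro comp_intros)
  from decP_comp[OF assms(1) this] show ?thesis by simp
qed

lemma computable_code_const: "computable f \<Longrightarrow> computable (\<lambda>x. code (const_recf (f x)))"
proof -
  assume f: "computable f"
  have "code (const_recf n) = rec_nat (code Zf)
      (\<lambda>_ r. prod_encode (3, prod_encode (code Sf, lcons r 0))) n" for n
    by (induction n) (simp_all add: lcons_def list_encode.simps)
  then show ?thesis by (simp only:) (intro comp_intros f)
qed

text \<open>The s-m-n theorem.\<close>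
lemma parametrized_relation:
  assumes "decP (\<lambda>p. R (pfst p) (pfst (psnd p)) (psnd (psnd p)))"
  shows "\<exists>f. computable f \<and> (\<forall>x u v. ev (decode (f x)) [u, v] (of_bool (R x u v)))"
proof -
  obtain c where c: "\<And>p. ev c [p] (of_bool (R (pfst p) (pfst (psnd p)) (psnd (psnd p))))"
    using assms unfolding decP_def computable_def computable_in_def by blast
  have "rfun 2 (\<lambda>xs. prod_encode (xs ! 0, xs ! 1))" by (intro rfun_pair rfun_proj) simp_all
  then obtain d where d: "\<And>xs. length xs = 2 \<Longrightarrow> ev d xs (prod_encode (xs ! 0, xs ! 1))"
    unfolding rfun_def by blast
  have pair: "ev (Cf d [g, h]) xs (prod_encode (a, b))" if "ev g xs a" "ev h xs b" for g h xs a b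
    by (rule ev_C[of _ _ _ "[a, b]"]) (use that d[of "[a, b]"] in auto)
  \<comment> \<open>The parameter enters as a constant subprogram, so the code of \<open>r x\<close>
    depends computably on \<open>x\<close>.\<close>
  define r where "r x = Cf c [Cf d [const_recf x, Cf d [Pf 0, Pf 1]]]" for x
  have "ev (r x) [u, v] (of_bool (R x u v))" for x u v
  proof -
    have "ev (Pf 0) [u, v] u" "ev (Pf 1) [u, v] v"
      using ev_P[of 0 "[u, v]"] ev_P[of 1 "[u, v]"] by auto
    then have "ev (Cf d [const_recf x, Cf d [Pf 0, Pf 1]]) [u, v] (prod_encode (x, prod_encode (u, v)))"
      by (intro pair ev_const_recf)
    moreover have "ev c [prod_encode (x, prod_encode (u, v))] (of_bool (R x u v))"
      using c[of "prod_encode (x, prod_encode (u, v))"] by simp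
    ultimately show ?thesis unfolding r_def
      by (intro ev_C[of _ _ _ "[prod_encode (x, prod_encode (u, v))]"]) simp_all
  qed
  moreover have "computable (\<lambda>x. code (r x))"
  proof -
    have "code (r x) = prod_encode (3, prod_encode (code c, lcons (prod_encode (3, prod_encode (code d,
        lcons (code (const_recf x)) (lcons (code (Cf d [Pf 0, Pf 1])) 0)))) 0))" for x
      by (simp add: r_def lcons_def list_encode.simps)
    then show ?thesis by (simp only:) (intro comp_intros computable_code_const)
  qed
  ultimately show ?thesis by (intro exI[of _ "\<lambda>x. code (r x)"]) simp
qed

text \<open>Having equal labels is an equivalence relation whatever the labels are, so every
  computable labelling yields indices of total structures.\<close>

lemma labelled_structure:
  assumes "computable (\<lambda>p. lab (pfst p) (psnd p))"
  shows "\<exists>f. computable f \<and> (\<forall>x. C_is_structure (f x) \<and> (\<forall>u v. Crel (f x) u v \<longleftrightarrow> lab x u = lab x v))"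
proof -
  have "decP (\<lambda>p. lab (pfst p) (pfst (psnd p)) = lab (pfst p) (psnd (psnd p)))"
    by (intro comp_intros computable_comp2[OF assms])
  from parametrized_relation[OF this] obtain f where f: "computable f"
    "\<And>x u v. ev (decode (f x)) [u, v] (of_bool (lab x u = lab x v))" by blast
  have C: "Crel (f x) u v \<longleftrightarrow> lab x u = lab x v" for x u v
    unfolding Crel_def using f(2)[of x u v] eval_deterministic[OF f(2)[of x u v], of 1]
    by (cases "lab x u = lab x v") auto
  have "of_bool b \<le> (1::nat)" for b by simp
  then have "C_is_structure (f x)" for x
    unfolding C_is_structure_def equivalence_structure_iff C using f(2) by metis
  then show ?thesis using f(1) C by blast
qed

text \<open>Classes correspond to the labels that are attained, so counting classes becomes counting
  labels, without choosing representatives.\<close>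

lemma indep_labels:
  assumes E: "\<And>u v. E u v \<longleftrightarrow> lab u = lab v"
  shows "(\<exists>I. card I = k \<and> indep UNIV E I \<and> (\<forall>x\<in>I. Q (cls UNIV E x))) \<longleftrightarrow>
    (\<exists>A. card A = k \<and> finite A \<and> A \<subseteq> range lab \<and> (\<forall>l\<in>A. Q {u. lab u = l}))"
proof -
  have cls: "cls UNIV E x = {u. lab u = lab x}" for x unfolding cls_def E by auto
  have indep: "indep UNIV E I \<longleftrightarrow> finite I \<and> inj_on lab I" for I
    unfolding indep_def E inj_on_def by simp
  show ?thesis
  proof
    assume "\<exists>I. card I = k \<and> indep UNIV E I \<and> (\<forall>x\<in>I. Q (cls UNIV E x))"
    then obtain I where "card I = k" "finite I" "inj_on lab I" "\<forall>x\<in>I. Q {u. lab u = lab x}"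
      unfolding indep cls by blast
    then show "\<exists>A. card A = k \<and> finite A \<and> A \<subseteq> range lab \<and> (\<forall>l\<in>A. Q {u. lab u = l})"
      by (intro exI[of _ "lab ` I"]) (auto simp: card_image)
  next
    assume "\<exists>A. card A = k \<and> finite A \<and> A \<subseteq> range lab \<and> (\<forall>l\<in>A. Q {u. lab u = l})"
    then obtain A where A: "card A = k" "finite A" "A \<subseteq> range lab" "\<forall>l\<in>A. Q {u. lab u = l}" by blast
    have g: "lab (inv lab l) = l" if "l \<in> A" for l using that A(3) by (auto intro: f_inv_into_f)
    then have "inj_on (inv lab) A" by (metis inj_on_inverseI)
    moreover have "inj_on lab (inv lab ` A)" using g by (auto simp: inj_on_def)
    ultimately show "\<exists>I. card I = k \<and> indep UNIV E I \<and> (\<forall>x\<in>I. Q (cls UNIV E x))"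
      unfolding indep cls using A g by (intro exI[of _ "inv lab ` A"]) (simp add: card_image)
  qed
qed

text \<open>The set consists of the pairs \<open>(n, b)\<close> where \<open>b\<close> is the least common bound for witnesses of
  the first \<open>n\<close> instances; this turns a \<open>\<Pi>\<^sub>2\<close> statement into the infinity of a decidable set.\<close>
lemma infinite_least_bounds:
  fixes R :: "nat \<Rightarrow> nat \<Rightarrow> bool"
  defines "G \<equiv> \<lambda>n b. \<forall>w<n. \<exists>v<Suc b. R w v"
  shows "infinite {s. G (pfst s) (psnd s) \<and> (\<forall>b<psnd s. \<not> G (pfst s) b)} \<longleftrightarrow> (\<forall>w. \<exists>v. R w v)"
    (is "infinite ?S \<longleftrightarrow> _")
proof
  define g where "g n = prod_encode (n, LEAST b. G n b)" for n
  { assume "\<forall>w. \<exists>v. R w v"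
    then obtain v where v: "\<And>w. R w (v w)" by metis
    have "G n (\<Sum>w<n. v w)" for n
      unfolding G_def
    proof (intro allI impI)
      fix w assume "w < n"
      then have "v w \<le> (\<Sum>w<n. v w)" by (intro member_le_sum) auto
      then show "\<exists>a<Suc (\<Sum>w<n. v w). R w a" using v[of w] by (intro exI[of _ "v w"]) simp
    qed
    then have G: "G n (LEAST b. G n b)" for n by (rule LeastI)
    have "g n \<in> ?S" for n
    proof -
      have "\<not> G n b" if "b < (LEAST b. G n b)" for b using not_less_Least[OF that] .
      then show ?thesis unfolding g_def mem_Collect_eq pfst_pair psnd_pair
        using G[of n] by (intro conjI allI impI)
    qed
    then have "range g \<subseteq> ?S" by (rule image_subsetI)
    moreover have "infinite (range g)" unfolding g_def by (intro range_inj_infinite injI) simp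
    ultimately show "infinite ?S" by (rule infinite_super) }
  assume inf: "infinite ?S"
  show "\<forall>w. \<exists>v. R w v"
  proof (rule ccontr)
    assume "\<not> (\<forall>w. \<exists>v. R w v)"
    then obtain w where w: "\<And>v. \<not> R w v" by blast
    have "?S \<subseteq> g ` {..w}"
    proof
      fix s assume s: "s \<in> ?S"
      have G: "G (pfst s) (psnd s)" and least: "\<And>b. b < psnd s \<Longrightarrow> \<not> G (pfst s) b"
        using s by simp_all
      have "\<not> w < pfst s" using G w unfolding G_def by blast
      moreover have "(LEAST b. G (pfst s) b) = psnd s"
        by (rule Least_equality[of "G (pfst s)", OF G]) (meson least not_less)
      then have "s = g (pfst s)" by (simp add: g_def)
      ultimately show "s \<in> g ` {..w}" by auto
    qed
    then show False using inf finite_surj by blast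
  qed
qed

text \<open>Three unfoldings through complements give the prefix \<exists>y \<forall>w \<exists>v
  over a decidable matrix; the inner \<forall>\<exists> part then becomes the infinity of a
  decidable column.\<close>

lemma Sigma3_infinite:
  assumes "S \<in> Sigma0 3"
  shows "\<exists>F. decP (\<lambda>p. F (pfst p) (pfst (psnd p)) (psnd (psnd p))) \<and>
    (\<forall>x. x \<in> S \<longleftrightarrow> (\<exists>y. infinite {s. F x y s}))"
proof -
  have "Sg (Suc (Suc (Suc 0))) (\<lambda>x. x \<in> S)" using assms by (simp add: Sg_def numeral_3_eq_3)
  then obtain Q1 where Q1: "Sg (Suc (Suc 0)) (\<lambda>z. \<not> Q1 z)" "\<And>x. x \<in> S \<longleftrightarrow> (\<exists>y. Q1 (prod_encode (x, y)))"
    unfolding Sg_Suc[of "Suc (Suc 0)"] by blast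
  obtain Q2 where Q2: "Sg (Suc 0) (\<lambda>z. \<not> Q2 z)" "\<And>x. \<not> Q1 x \<longleftrightarrow> (\<exists>y. Q2 (prod_encode (x, y)))"
    using Q1(1) unfolding Sg_Suc[of "Suc 0"] by blast
  obtain Q3 where Q3: "Sg 0 (\<lambda>z. \<not> Q3 z)" "\<And>x. \<not> Q2 x \<longleftrightarrow> (\<exists>y. Q3 (prod_encode (x, y)))"
    using Q2(1) unfolding Sg_Suc[of 0] by blast
  define R where "R x y w v \<longleftrightarrow> Q3 (prod_encode (prod_encode (prod_encode (x, y), w), v))" for x y w v
  have "Q1 z \<longleftrightarrow> (\<forall>w. \<not> Q2 (prod_encode (z, w)))" for z using Q2(2)[of z] by blast
  then have S: "x \<in> S \<longleftrightarrow> (\<exists>y. \<forall>w. \<exists>v. R x y w v)" for x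
    by (simp only: Q1(2) R_def Q3(2))
  define F where "F x y s \<longleftrightarrow> (\<forall>w<pfst s. \<exists>v<Suc (psnd s). R x y w v) \<and>
    (\<forall>b<psnd s. \<not> (\<forall>w<pfst s. \<exists>v<Suc b. R x y w v))" for x y s
  have "decP Q3" using decP_not[OF Q3(1)[unfolded Sg_0]] by simp
  then have "decP (\<lambda>p. F (pfst p) (pfst (psnd p)) (psnd (psnd p)))"
    unfolding F_def R_def by (intro comp_intros decP_comp[OF \<open>decP Q3\<close>])
  moreover have "x \<in> S \<longleftrightarrow> (\<exists>y. infinite {s. F x y s})" for x
    unfolding S F_def infinite_least_bounds ..
  ultimately show ?thesis by blast
qed

text \<open>The version number in the label of an element of column \<open>y\<close>. As a bounded
  cardinality it is computable from a decidable \<open>F\<close>.\<close>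

definition fire_count :: "(nat \<Rightarrow> nat \<Rightarrow> bool) \<Rightarrow> nat \<Rightarrow> nat \<Rightarrow> nat" where
  "fire_count F y s = card {t. t < s \<and> (\<exists>z<y. F z t)}"

text \<open>If \<open>y\<close> is least with infinitely many \<open>F y s\<close>, then \<open>fire_count F y\<close> is eventually constant
  and gives one infinite fibre; above \<open>y\<close> the count tends to infinity, so its fibres are finite.\<close>
lemma infinite_fibre_of_fire_count:
  fixes F :: "nat \<Rightarrow> nat \<Rightarrow> bool"
  defines "A \<equiv> {(y, c). infinite {s. F y s \<and> fire_count F y s = c}}"
  shows "(\<And>y. finite {s. F y s}) \<Longrightarrow> A = {}" "infinite {s. F y s} \<Longrightarrow> \<exists>a. A = {a}"
proof -
  assume fin: "\<And>y. finite {s. F y s}"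
  have "finite {s. F y s \<and> fire_count F y s = c}" for y c by (rule finite_subset[OF _ fin[of y]]) auto
  then show "A = {}" unfolding A_def by simp
next
  assume inf: "infinite {s. F y s}"
  define y0 where "y0 = (LEAST y. infinite {s. F y s})"
  have y0: "infinite {s. F y0 s}" unfolding y0_def using inf by (rule LeastI)
  have below: "finite {s. F z s}" if "z < y0" for z
    using not_less_Least[of z "\<lambda>y. infinite {s. F y s}"] that unfolding y0_def by blast
  have mono: "fire_count F z s \<le> fire_count F z s'" if "s \<le> s'" for z s s'
    unfolding fire_count_def by (rule card_mono) (use that in auto)
  have fires: "finite {t. \<exists>z<y0. F z t}"
  proof -
    have "{t. \<exists>z<y0. F z t} = (\<Union>z\<in>{..<y0}. {t. F z t})" by auto
    then show ?thesis using below by simp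
  qed
  \<comment> \<open>From stage \<open>b\<close> on the earlier columns are silent, and the count for
    \<open>y0\<close> no longer changes.\<close>
  then obtain b where "\<forall>t\<in>{t. \<exists>z<y0. F z t}. t < b" using finite_nat_set_iff_bounded by blast
  then have b: "t < b" if "z < y0" "F z t" for z t using that by blast
  have const: "fire_count F y0 s = fire_count F y0 b" if "b \<le> s" for s
  proof -
    have "t < s \<and> (\<exists>z<y0. F z t) \<longleftrightarrow> t < b \<and> (\<exists>z<y0. F z t)" for t using b that less_le_trans by blast
    then show ?thesis unfolding fire_count_def by simp
  qed
  have "A = {(y0, fire_count F y0 b)}"
  proof (rule set_eqI)
    fix a :: "nat \<times> nat"
    obtain z c where a: "a = (z, c)" by fastforce
    show "a \<in> A \<longleftrightarrow> a \<in> {(y0, fire_count F y0 b)}"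
    proof
      assume "a \<in> A"
      then have zc: "infinite {s. F z s \<and> fire_count F z s = c}" by (simp add: A_def a)
      then have "infinite {s. F z s}" by (rule infinite_super[rotated]) auto
      then have "y0 \<le> z" using below by (meson not_less)
      moreover have "\<not> y0 < z"
      proof
        assume "y0 < z"
        \<comment> \<open>\<open>c + 1\<close> elements of column \<open>y0\<close> push the count
          of every later column beyond \<open>c\<close> for good.\<close>
        obtain B where B: "B \<subseteq> {s. F y0 s}" "card B = Suc c" "finite B"
          using infinite_arbitrarily_large[OF y0] by blast
        then obtain m where m: "\<forall>t\<in>B. t < m" using finite_nat_set_iff_bounded by blast
        have "c < fire_count F z s" if "m \<le> s" for s
        proof -
          have "B \<subseteq> {t. t < s \<and> (\<exists>y<z. F y t)}"
          proof
            fix t assume "t \<in> B"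
            then have "t < s" "F y0 t" using B(1) m that by auto
            then show "t \<in> {t. t < s \<and> (\<exists>y<z. F y t)}" using \<open>y0 < z\<close> by blast
          qed
          then have "card B \<le> fire_count F z s" unfolding fire_count_def by (intro card_mono) auto
          then show ?thesis using B(2) by simp
        qed
        then have "s < m" if "F z s \<and> fire_count F z s = c" for s using that by (metis less_irrefl not_less)
        then have "{s. F z s \<and> fire_count F z s = c} \<subseteq> {..<m}" by auto
        then have "finite {s. F z s \<and> fire_count F z s = c}" by (rule finite_subset) simp
        then show False using zc by simp
      qed
      ultimately have z: "z = y0" by simp
      obtain s where "b \<le> s" "fire_count F y0 s = c"
        using zc unfolding z infinite_nat_iff_unbounded_le by blast
      then have "c = fire_count F y0 b" using const[of s] by simp
      then show "a \<in> {(y0, fire_count F y0 b)}" by (simp add: a z)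
    next
      assume "a \<in> {(y0, fire_count F y0 b)}"
      then have zc: "z = y0" "c = fire_count F y0 b" by (simp_all add: a)
      have "{s. F y0 s} \<subseteq> {s. F y0 s \<and> fire_count F y0 s = c} \<union> {..<b}"
      proof
        fix s assume "s \<in> {s. F y0 s}"
        then show "s \<in> {s. F y0 s \<and> fire_count F y0 s = c} \<union> {..<b}"
          using const[of s] zc(2) by (cases "b \<le> s") simp_all
      qed
      from infinite_super[OF this y0] have "infinite {s. F y0 s \<and> fire_count F y0 s = c}" by simp
      then show "a \<in> A" by (simp add: A_def a zc(1))
    qed
  qed
  then show "\<exists>a. A = {a}" by blast
qed

text \<open>Tag 0 supplies classes of every finite size; tag 1 one infinite class iff some \<open>FS x y\<close> is
  infinite; tags 2 and 3 two infinite classes for each infinite \<open>FP x y\<close>; the next \<open>K\<close> tags one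
  infinite class each. All other elements are alone in their class.\<close>
definition lab :: "(nat \<Rightarrow> nat \<Rightarrow> nat \<Rightarrow> bool) \<Rightarrow> (nat \<Rightarrow> nat \<Rightarrow> nat \<Rightarrow> bool) \<Rightarrow> nat \<Rightarrow> nat \<Rightarrow> nat \<Rightarrow> nat" where
  "lab FS FP K x u = (let t = pfst u; a = pfst (psnd u); b = psnd (psnd u) in
     if t = 0 \<and> b \<le> a then prod_encode (0, a)
     else if t = 1 \<and> FS x a b then prod_encode (2, prod_encode (a, fire_count (FS x) a b))
     else if t = 2 \<and> FP x a b then prod_encode (3, a)
     else if t = 3 \<and> FP x a b then prod_encode (4, a)
     else if 4 \<le> t \<and> t < 4 + K then prod_encode (5, t)
     else prod_encode (1, u))"

lemma computable_lab:
  assumes "decP (\<lambda>p. FS (pfst p) (pfst (psnd p)) (psnd (psnd p)))"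
    "decP (\<lambda>p. FP (pfst p) (pfst (psnd p)) (psnd (psnd p)))"
  shows "computable (\<lambda>p. lab FS FP K (pfst p) (psnd p))"
  unfolding lab_def Let_def fire_count_def
  by (intro comp_intros decP3_comp[OF assms(1)] decP3_comp[OF assms(2)])

lemma pair_cases: obtains t a b where "u = prod_encode (t, prod_encode (a, b))"
  by (metis pair_eta)

context
  fixes FS FP :: "nat \<Rightarrow> nat \<Rightarrow> nat \<Rightarrow> bool" and K x :: nat
begin

abbreviation "L \<equiv> lab FS FP K x"

text \<open>The first component of a label names the clause that produced it, so fibres of different
  clauses never merge. For the default clause there is an inclusion instead of an equation, since
  \<open>v\<close> itself may fall under another clause.\<close>

lemma lab_fibre:
  "{u. L u = prod_encode (0, a)} = (\<lambda>b. prod_encode (0, prod_encode (a, b))) ` {..a}"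
  "{u. L u = prod_encode (1, v)} \<subseteq> {v}"
  "{u. L u = prod_encode (2, prod_encode (a, c))} =
     (\<lambda>b. prod_encode (1, prod_encode (a, b))) ` {b. FS x a b \<and> fire_count (FS x) a b = c}"
  "{u. L u = prod_encode (3, a)} = (\<lambda>b. prod_encode (2, prod_encode (a, b))) ` {b. FP x a b}"
  "{u. L u = prod_encode (4, a)} = (\<lambda>b. prod_encode (3, prod_encode (a, b))) ` {b. FP x a b}"
  "4 \<le> t \<Longrightarrow> t < 4 + K \<Longrightarrow> {u. L u = prod_encode (5, t)} = range (\<lambda>b. prod_encode (t, b))"
proof -
  have *: "A = B" if "\<And>t a b. prod_encode (t, prod_encode (a, b)) \<in> A \<longleftrightarrow> prod_encode (t, prod_encode (a, b)) \<in> B"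
    for A B :: "nat set"
    using that pair_cases by (metis set_eqI)
  show "{u. L u = prod_encode (0, a)} = (\<lambda>b. prod_encode (0, prod_encode (a, b))) ` {..a}"
    by (rule *) (auto simp: lab_def Let_def)
  show "{u. L u = prod_encode (1, v)} \<subseteq> {v}" by (auto simp: lab_def Let_def split: if_splits)
  show "{u. L u = prod_encode (2, prod_encode (a, c))} =
     (\<lambda>b. prod_encode (1, prod_encode (a, b))) ` {b. FS x a b \<and> fire_count (FS x) a b = c}"
    by (rule *) (auto simp: lab_def Let_def)
  show "{u. L u = prod_encode (3, a)} = (\<lambda>b. prod_encode (2, prod_encode (a, b))) ` {b. FP x a b}"
    by (rule *) (auto simp: lab_def Let_def)
  show "{u. L u = prod_encode (4, a)} = (\<lambda>b. prod_encode (3, prod_encode (a, b))) ` {b. FP x a b}"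
    by (rule *) (auto simp: lab_def Let_def)
  show "{u. L u = prod_encode (5, t)} = range (\<lambda>b. prod_encode (t, b))" if "4 \<le> t" "t < 4 + K"
    by (rule *) (use that in \<open>auto simp: lab_def Let_def\<close>)
qed

lemma infinite_lab_fibre_iff: "infinite {u. L u = l} \<longleftrightarrow>
  (\<exists>a c. l = prod_encode (2, prod_encode (a, c)) \<and> infinite {b. FS x a b \<and> fire_count (FS x) a b = c}) \<or>
  (\<exists>a. (l = prod_encode (3, a) \<or> l = prod_encode (4, a)) \<and> infinite {b. FP x a b}) \<or>
  (\<exists>t. l = prod_encode (5, t) \<and> 4 \<le> t \<and> t < 4 + K)" (is "_ \<longleftrightarrow> ?R")
proof -
  have inj: "finite ((\<lambda>b. prod_encode (t, prod_encode (a, b))) ` B) \<longleftrightarrow> finite B" for t a B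
    by (rule finite_image_iff) (simp add: inj_on_def)
  have inj': "infinite (range (\<lambda>b. prod_encode (t, b)))" for t
    by (rule range_inj_infinite) (simp add: inj_def)
  show ?thesis
  proof
    assume inf: "infinite {u. L u = l}"
    then obtain u where "L u = l" by (metis (mono_tags) empty_Collect_eq finite.emptyI)
    then consider a where "l = prod_encode (0, a)" | v where "l = prod_encode (1, v)"
      | a c where "l = prod_encode (2, prod_encode (a, c))" | a where "l = prod_encode (3, a)"
      | a where "l = prod_encode (4, a)" | t where "l = prod_encode (5, t)" "4 \<le> t" "t < 4 + K"
      unfolding lab_def Let_def by (auto split: if_splits)
    then show ?R
    proof cases
      case 1 then show ?thesis using inf by (simp add: lab_fibre(1) inj)
    next
      case (2 v)
      have "finite {u. L u = l}" unfolding 2 using lab_fibre(2)[of v] by (rule finite_subset) simp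
      then show ?thesis using inf by blast
    next
      case 3 then show ?thesis using inf by (simp add: lab_fibre(3) inj)
    next
      case 4 then show ?thesis using inf by (simp add: lab_fibre(4) inj)
    next
      case 5 then show ?thesis using inf by (simp add: lab_fibre(5) inj)
    next
      case 6 then show ?thesis by blast
    qed
  next
    assume ?R
    then show "infinite {u. L u = l}"
      by (elim disjE exE conjE) (simp_all add: lab_fibre(3-6) inj inj')
  qed
qed

lemma inf_cls_ge_lab:
  assumes E: "\<And>u v. E u v \<longleftrightarrow> L u = L v"
  shows "finite A \<Longrightarrow> \<forall>l\<in>A. infinite {u. L u = l} \<Longrightarrow> k \<le> card A \<Longrightarrow> inf_cls_ge UNIV E k"
    and "finite B \<Longrightarrow> (\<And>l. infinite {u. L u = l} \<Longrightarrow> l \<in> B) \<Longrightarrow> inf_cls_ge UNIV E k \<Longrightarrow> k \<le> card B"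
proof -
  have *: "inf_cls_ge UNIV E k \<longleftrightarrow>
    (\<exists>A. card A = k \<and> finite A \<and> A \<subseteq> range L \<and> (\<forall>l\<in>A. infinite {u. L u = l}))" for k
    unfolding inf_cls_ge_def by (rule indep_labels[OF E])
  show "inf_cls_ge UNIV E k" if A: "finite A" "\<forall>l\<in>A. infinite {u. L u = l}" "k \<le> card A"
  proof -
    obtain A' where A': "A' \<subseteq> A" "card A' = k" "finite A'" using obtain_subset_with_card_n[OF A(3)] .
    \<comment> \<open>An infinite fibre is nonempty, so its label is attained.\<close>
    have "l \<in> range L" if "l \<in> A'" for l
    proof (rule ccontr)
      assume "l \<notin> range L"
      then have "{u. L u = l} = {}" by auto
      then show False using A(2) A'(1) that by (metis finite.emptyI subsetD)
    qed
    then show ?thesis unfolding * using A' A(2) by blast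
  qed
  show "k \<le> card B" if B: "finite B" "\<And>l. infinite {u. L u = l} \<Longrightarrow> l \<in> B" "inf_cls_ge UNIV E k"
  proof -
    obtain A where A: "card A = k" "\<forall>l\<in>A. infinite {u. L u = l}" using B(3) unfolding * by blast
    then have "A \<subseteq> B" using B(2) by blast
    then show ?thesis using card_mono[OF B(1)] A(1) by blast
  qed
qed

lemma large_cls_ge_lab:
  assumes E: "\<And>u v. E u v \<longleftrightarrow> L u = L v"
  shows "large_cls_ge UNIV E k"
  unfolding large_cls_ge_def
proof
  fix n
  \<comment> \<open>The fibre of \<open>prod_encode (0, a)\<close> has \<open>a + 1\<close> elements
    whatever the parameters are, so the labels from \<open>n\<close> on are large enough.\<close>
  let ?l = "\<lambda>i. prod_encode (0, n + i)"
  have "card {u. L u = ?l i} = Suc (n + i)" for i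
    unfolding lab_fibre(1) by (subst card_image) (simp_all add: inj_on_def)
  then have "at_least n {u. L u = ?l i}" for i by (simp add: at_least_def)
  moreover have "L (prod_encode (0, prod_encode (n + i, 0))) = ?l i" for i
    by (simp add: lab_def Let_def)
  then have "?l i \<in> range L" for i by (metis rangeI)
  moreover have "card (?l ` {..<k}) = k" by (subst card_image) (simp_all add: inj_on_def)
  ultimately have "\<exists>A. card A = k \<and> finite A \<and> A \<subseteq> range L \<and> (\<forall>l\<in>A. at_least n {u. L u = l})"
    by (intro exI[of _ "?l ` {..<k}"]) auto
  then show "\<exists>I. card I = k \<and> indep UNIV E I \<and> (\<forall>x\<in>I. at_least n (cls UNIV E x))"
    unfolding indep_labels[where Q = "at_least n", OF E] .
qed

text \<open>If some \<open>FP x y\<close> is infinite there is a lower bound only, as many columns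
  may be infinite at once. Otherwise the infinite fibres are known exactly: the \<open>K\<close>
  permanent ones and at most one version of one column of \<open>FS x\<close>.\<close>

lemma inf_cls_ge_lab_iff:
  assumes E: "\<And>u v. E u v \<longleftrightarrow> L u = L v"
  shows "infinite {s. FP x y s} \<Longrightarrow> j \<le> K + 2 \<Longrightarrow> inf_cls_ge UNIV E j"
    and "(\<And>y. finite {s. FP x y s}) \<Longrightarrow>
      inf_cls_ge UNIV E j \<longleftrightarrow> j \<le> K + of_bool (\<exists>y. infinite {s. FS x y s})"
proof -
  let ?C = "(\<lambda>t. prod_encode (5, t)) ` {4..<4 + K}"
  have "card ?C = card {4..<4 + K}" by (rule card_image) (simp add: inj_on_def)
  then have C: "card ?C = K" "finite ?C" by simp_all
  show "inf_cls_ge UNIV E j" if y: "infinite {s. FP x y s}" and j: "j \<le> K + 2"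
  proof (rule inf_cls_ge_lab(1)[OF E])
    let ?A = "insert (prod_encode (3, y)) (insert (prod_encode (4, y)) ?C)"
    show "finite ?A" "\<forall>l\<in>?A. infinite {u. L u = l}" using y by (auto simp: infinite_lab_fibre_iff)
    have "card ?A = Suc (Suc K)" using C by (auto simp: card_insert_if image_iff)
    then show "j \<le> card ?A" using j by simp
  qed
  show "inf_cls_ge UNIV E j \<longleftrightarrow> j \<le> K + of_bool (\<exists>y. infinite {s. FS x y s})"
    if fin: "\<And>y. finite {s. FP x y s}"
  proof -
    let ?M = "{(y, c). infinite {s. FS x y s \<and> fire_count (FS x) y s = c}}"
    let ?B = "?C \<union> (\<lambda>a. prod_encode (2, prod_encode a)) ` ?M"
    have iff: "infinite {u. L u = l} \<longleftrightarrow> l \<in> ?B" for l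
      unfolding infinite_lab_fibre_iff using fin by auto
    have card: "finite ?B \<and> card ?B = K + of_bool (\<exists>y. infinite {s. FS x y s})"
    proof (cases "\<exists>y. infinite {s. FS x y s}")
      case True
      then obtain a where "?M = {a}" using infinite_fibre_of_fire_count(2)[of "FS x"] by blast
      then have B: "?B = insert (prod_encode (2, prod_encode a)) ?C" by simp
      have "prod_encode (2, prod_encode a) \<notin> ?C" by auto
      then show ?thesis unfolding B using True C by simp
    next
      case False
      then have "?M = {}" by (intro infinite_fibre_of_fire_count(1)) blast
      then have B: "?B = ?C" by simp
      show ?thesis unfolding B using False C by simp
    qed
    show ?thesis
    proof
      assume "inf_cls_ge UNIV E j"
      with card show "j \<le> K + of_bool (\<exists>y. infinite {s. FS x y s})"
        using inf_cls_ge_lab(2)[OF E, of ?B j] iff by simp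
    next
      assume "j \<le> K + of_bool (\<exists>y. infinite {s. FS x y s})"
      with card have "finite ?B" "j \<le> card ?B" by simp_all
      then show "inf_cls_ge UNIV E j" using inf_cls_ge_lab(1)[OF E, of ?B j] iff by blast
    qed
  qed
qed

end

section \<open>The reduction\<close>

lemma bi_emb_index_set_lower:
  assumes A: "equivalence_structure U E" "\<And>m. \<not> few_above U E m"
    "inf_cls_ge U E k" "\<not> inf_cls_ge U E (Suc k)"
    and S: "S \<in> Sigma0 3" and P: "P \<in> Pi0 3" and k: "k = 0 \<Longrightarrow> S = UNIV"
  shows "many_one_le (S \<inter> P) (bi_emb_index_set U E)"
proof -
  obtain F where F: "decP (\<lambda>p. F (pfst p) (pfst (psnd p)) (psnd (psnd p)))"
    "\<And>x. x \<in> S \<longleftrightarrow> (\<exists>y. infinite {s. F x y s})"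
    using Sigma3_infinite[OF S] by blast
  have "- P \<in> Sigma0 3" using P by (simp add: Pi0_def)
  then obtain FP where FP: "decP (\<lambda>p. FP (pfst p) (pfst (psnd p)) (psnd (psnd p)))"
    "\<And>x. x \<notin> P \<longleftrightarrow> (\<exists>y. infinite {s. FP x y s})"
    using Sigma3_infinite[of "- P"] by (metis Compl_iff)
  \<comment> \<open>For \<open>k = 0\<close> the Sigma_3 part is switched off; otherwise
    \<open>S = UNIV\<close> would create an infinite class.\<close>
  define FS where "FS x y s \<longleftrightarrow> k > 0 \<and> F x y s" for x y s
  have FS: "decP (\<lambda>p. FS (pfst p) (pfst (psnd p)) (psnd (psnd p)))"
    unfolding FS_def by (intro comp_intros F(1))
  \<comment> \<open>With \<open>k - 1\<close> permanent classes, a number truncated at 0, the total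
    reaches \<open>k\<close> iff \<open>x \<in> S\<close> and never exceeds it.\<close>
  have count: "k \<le> (k - 1) + of_bool (\<exists>y. infinite {s. FS x y s}) \<longleftrightarrow> x \<in> S"
    "\<not> Suc k \<le> (k - 1) + of_bool (\<exists>y. infinite {s. FS x y s})" for x
    using F(2)[of x] k unfolding FS_def by (cases k; auto)+
  obtain f where f: "computable f" "\<And>x. C_is_structure (f x)"
    "\<And>x u v. Crel (f x) u v \<longleftrightarrow> lab FS FP (k - 1) x u = lab FS FP (k - 1) x v"
    using labelled_structure[OF computable_lab[OF FS FP(1), of "k - 1"]] by blast
  have "x \<in> S \<inter> P \<longleftrightarrow> f x \<in> bi_emb_index_set U E" for x
  proof (cases "x \<in> P")
    case True
    then have "\<And>y. finite {s. FP x y s}" using FP(2) by blast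
    note iff = inf_cls_ge_lab_iff(2)[OF f(3) this]
    show ?thesis
      unfolding bi_emb_index_set_iff[OF A] iff
      using f(2) large_cls_ge_lab[OF f(3)] count[of x] True by blast
  next
    case False
    then obtain y where "infinite {s. FP x y s}" using FP(2) by blast
    \<comment> \<open>\<open>(k - 1) + 2\<close> is at least \<open>k + 1\<close>, also for
      \<open>k = 0\<close> with truncated subtraction.\<close>
    from inf_cls_ge_lab_iff(1)[OF f(3) this, of "Suc k"]
    have "inf_cls_ge UNIV (Crel (f x)) (Suc k)" by simp
    then show ?thesis unfolding bi_emb_index_set_iff[OF A] using False by blast
  qed
  then show ?thesis unfolding many_one_le_def using f(1) by blast
qed

text \<open>Presents a Pi_3 set as its intersection with a trivial Sigma_3 set, for the case without
  infinite classes.\<close>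

lemma UNIV_Sigma0: "UNIV \<in> Sigma0 n"
  using Sg_of_decP[OF decP_const[of True], of n] by (simp add: Sg_def)

theorem theorem4p3:
  fixes U :: "nat set" and E :: "nat \<Rightarrow> nat \<Rightarrow> bool"
  assumes "computable_structure U E"
    and "equivalence_structure U E"
    and "bec_degree_is_jump U E"
  shows "(infinite_classes U E = {} \<longrightarrow> complete_for (Pi0 3) (bi_emb_index_set U E))
    \<and> (\<forall>k::nat. 0 < k \<and> finite (infinite_classes U E) \<and> card (infinite_classes U E) = k
          \<longrightarrow> complete_for (D0 3) (bi_emb_index_set U E))"
proof (intro conjI impI allI)
  note few = bec_jump_not_few_above[OF assms(2,3)]
  { assume "infinite_classes U E = {}"
    then have k: "inf_cls_ge U E 0" "\<not> inf_cls_ge U E (Suc 0)"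
      using inf_cls_ge_iff[OF assms(2)] by simp_all
    show "complete_for (Pi0 3) (bi_emb_index_set U E)"
      unfolding complete_for_def
      using bi_emb_index_set_upper(1)[OF assms(2) few k]
        bi_emb_index_set_lower[OF assms(2) few k UNIV_Sigma0] by simp }
  fix k assume "0 < k \<and> finite (infinite_classes U E) \<and> card (infinite_classes U E) = k"
  then have k: "0 < k" "inf_cls_ge U E k" "\<not> inf_cls_ge U E (Suc k)"
    using inf_cls_ge_iff[OF assms(2)] by simp_all
  show "complete_for (D0 3) (bi_emb_index_set U E)"
    unfolding complete_for_def
  proof
    show "bi_emb_index_set U E \<in> D0 3" by (rule bi_emb_index_set_upper(2)[OF assms(2) few k(2,3)])
    show "\<forall>T\<in>D0 3. many_one_le T (bi_emb_index_set U E)"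
      using bi_emb_index_set_lower[OF assms(2) few k(2,3)] k(1) unfolding D0_def by auto
  qed
qed

end
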